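(* Let $0<|q|<1$. For $xy\neq q$, there holds $$\sum_{n=1}^{\infty}\frac{(x,y;q)_n}{(q;q)_{2n-1}}\left(\frac1{xy}\right)^nq^{n^2-n}=(T_1-T_2)\frac{(q/x,q/y;q)_\infty}{(q,q/xy;q)_\infty},$$ where $T_1$ and $T_2$ are, respectively, given by $$T_1:=\sum_{n=-\infty}^{\infty}\frac{(x,y;q)_{3n+1}}{(q/x,q/y;q)_{3n+1}}\left(\frac1{xy}\right)^{3n+1}q^{3n^2+2n},$$ $$T_2:=\sum_{n=-\infty}^{\infty}\frac{(x,y;q)_{3n+2}}{(q/x,q/y;q)_{3n+2}}\left(\frac1{xy}\right)^{3n+2}q^{3n^2+4n+1}.$$
   Context: Here $x,y$ are the parameters of the identity and $q$ is the base. The $q$-shifted factorials are $(x;q)_\infty=\prod_{n=0}^{\infty}(1-xq^n)$ and $(x;q)_n=(x;q)_\infty/(xq^n;q)_\infty$ for all integers $n$ (including negative $n$). Compact notation: $(a_1,\dots,a_r;q)_n=(a_1;q)_n\cdots(a_r;q)_n$, also for $n=\infty$. Here $q/xy$ means $q/(xy)$.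
   Formalization: The condition xy ≠ q is replaced by xy ≠ q^{k+1} for all k ≥ 0 (otherwise (q/xy;q)_∞ = 0 in the denominator), and x, y are assumed nonzero and not of the form q^{k+1}, k ≥ 0 (otherwise terms of T_1 and T_2 are undefined). *)

theory Defs
  imports "HOL-Analysis.Analysis"
begin

definition qpoch_inf :: "complex \<Rightarrow> complex \<Rightarrow> complex" where
  "qpoch_inf a q = (\<Prod>k. 1 - a * q ^ k)"

text \<open>
  The \<open>q\<close>-shifted factorial \<open>(a;q)\<^sub>n\<close> for an integer index is the quotient
  \<open>(a;q)\<^sub>\<infinity> / (a q\<^sup>n;q)\<^sub>\<infinity>\<close>. If the denominator vanishes, that is, if
  \<open>a q\<^sup>n = q\<^sup>-\<^sup>m\<close> for some \<open>m \<ge> 0\<close>, the quotient is read, as usual, after cancellation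
  of the common factors: \<open>(1 - a) \<dots> (1 - a q\<^sup>n\<^sup>-\<^sup>1)\<close> for \<open>n \<ge> 0\<close>, and
  \<open>1 / ((1 - a q\<^sup>-\<^sup>1) \<dots> (1 - a q\<^sup>n))\<close> for \<open>n < 0\<close>. This matters for terminating series,
  where \<open>a = q\<^sup>-\<^sup>m\<close>. The lemma \<open>qpoch_eq\<close> below shows that
  the cancelled form agrees with the quotient in all other cases.

  At a genuine pole the value is \<open>1 / 0 = 0\<close>, so that a pole occurring in a
  denominator contributes \<open>1 / (a;q)\<^sub>n = 0\<close>, which is again the usual convention.
\<close>

definition qpoch :: "complex \<Rightarrow> complex \<Rightarrow> int \<Rightarrow> complex" where
  "qpoch a q n =
     (if qpoch_inf (a * q powi n) q \<noteq> 0 then qpoch_inf a q / qpoch_inf (a * q powi n) q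
      else if n \<ge> 0 then \<Prod>k<nat n. 1 - a * q ^ k
      else 1 / (\<Prod>k=1..nat (- n). 1 - a / q ^ k))"

lemma qpoch_inf_LIMSEQ:
  assumes "norm q < 1"
  shows "(\<lambda>n. \<Prod>k\<le>n. 1 - a * q ^ k) \<longlonglongrightarrow> qpoch_inf a q"
proof -
  have "summable (\<lambda>k. norm a * norm q ^ k)"
    using assms by (intro summable_mult summable_geometric) auto
  hence "abs_convergent_prod (\<lambda>k. 1 - a * q ^ k)"
    by (intro summable_imp_abs_convergent_prod) (simp add: norm_mult norm_power)
  thus ?thesis
    unfolding qpoch_inf_def
    by (intro convergent_prod_LIMSEQ abs_convergent_prod_imp_convergent_prod)
qed

lemma qpoch_inf_rec:
  assumes "norm q < 1"
  shows "qpoch_inf a q = (1 - a) * qpoch_inf (a * q) q"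
proof -
  have "(\<lambda>n. (1 - a) * (\<Prod>k\<le>n. 1 - (a * q) * q ^ k)) \<longlonglongrightarrow> (1 - a) * qpoch_inf (a * q) q"
    by (intro tendsto_mult tendsto_const qpoch_inf_LIMSEQ assms)
  also have "(\<lambda>n. (1 - a) * (\<Prod>k\<le>n. 1 - (a * q) * q ^ k)) = (\<lambda>n. \<Prod>k\<le>Suc n. 1 - a * q ^ k)"
    by (subst prod.atMost_Suc_shift) (simp add: mult_ac)
  finally have "(\<lambda>n. \<Prod>k\<le>Suc n. 1 - a * q ^ k) \<longlonglongrightarrow> (1 - a) * qpoch_inf (a * q) q" .
  with LIMSEQ_Suc[OF qpoch_inf_LIMSEQ[OF assms, of a]] show ?thesis
    by (rule LIMSEQ_unique)
qed

lemma qpoch_inf_split: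
  assumes "norm q < 1"
  shows "qpoch_inf a q = (\<Prod>k<n. 1 - a * q ^ k) * qpoch_inf (a * q ^ n) q"
proof (induction n)
  case (Suc n)
  show ?case
    using Suc qpoch_inf_rec[OF assms, of "a * q ^ n"] by (simp add: mult_ac)
qed simp

lemma qpoch_eq:
  assumes "0 < norm q" "norm q < 1"
  shows "qpoch a q n =
    (if n \<ge> 0 then \<Prod>k<nat n. 1 - a * q ^ k
     else 1 / (\<Prod>k=1..nat (- n). 1 - a / q ^ k))"
proof (cases "qpoch_inf (a * q powi n) q = 0")
  case False
  show ?thesis
  proof (cases "n \<ge> 0")
    case True
    with False qpoch_inf_split[OF assms(2), of a "nat n"] show ?thesis
      by (simp add: qpoch_def power_int_def)
  next
    case neg: False
    define N where "N = nat (- n)"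
    have q: "q \<noteq> 0" using assms by auto
    have b: "a * q powi n = a / q ^ N"
      using neg by (simp add: power_int_def N_def field_simps)
    have "qpoch_inf (a / q ^ N) q = (\<Prod>k<N. 1 - a / q ^ N * q ^ k) * qpoch_inf a q"
      using qpoch_inf_split[OF assms(2), of "a / q ^ N" N] q by simp
    also have "(\<Prod>k<N. 1 - a / q ^ N * q ^ k) = (\<Prod>k=1..N. 1 - a / q ^ k)"
      by (rule prod.reindex_bij_witness[of _ "\<lambda>k. N - k" "\<lambda>k. N - k"])
         (use q in \<open>auto simp: power_diff\<close>)
    finally show ?thesis
      using False neg b by (auto simp: qpoch_def N_def)
  qed
qed (simp add: qpoch_def)

definition T1_term :: "complex \<Rightarrow> complex \<Rightarrow> complex \<Rightarrow> int \<Rightarrow> complex" where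
  "T1_term x y q n =
     (qpoch x q (3*n+1) * qpoch y q (3*n+1)) / (qpoch (q/x) q (3*n+1) * qpoch (q/y) q (3*n+1))
     * (1 / (x*y)) powi (3*n+1) * q powi (3*n^2 + 2*n)"

definition T2_term :: "complex \<Rightarrow> complex \<Rightarrow> complex \<Rightarrow> int \<Rightarrow> complex" where
  "T2_term x y q n =
     (qpoch x q (3*n+2) * qpoch y q (3*n+2)) / (qpoch (q/x) q (3*n+2) * qpoch (q/y) q (3*n+2))
     * (1 / (x*y)) powi (3*n+2) * q powi (3*n^2 + 4*n + 1)"

definition T1 :: "complex \<Rightarrow> complex \<Rightarrow> complex \<Rightarrow> complex" where
  "T1 x y q = (\<Sum>\<^sub>\<infinity>n\<in>UNIV. T1_term x y q n)"

definition T2 :: "complex \<Rightarrow> complex \<Rightarrow> complex \<Rightarrow> complex" where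
  "T2 x y q = (\<Sum>\<^sub>\<infinity>n\<in>UNIV. T2_term x y q n)"

end

theory Submission
  imports Defs
begin

text \<open>
  The identity is the limiting Bailey lemma with \<open>a = 1\<close>, applied to a Bailey pair modulo 3.
  Write \<open>z = q/(xy)\<close>. Since the summands of both bilateral series carry the power
  \<open>q\<close> to the \<open>(m\<^sup>2 - 1)/3\<close>, with \<open>m = 3n + 1\<close> or \<open>m = 3n + 2\<close>, the difference of the two is a
  single series over all integers \<open>m\<close>, twisted by the character \<open>m \<mapsto> (m/3)\<close>. Up to a factor \<open>c\<^sub>m\<close>
  made of this twist and a Gaussian power of \<open>q\<close>, its summand is \<open>(x,y;q)\<^sub>m z\<^sup>m / (q/x,q/y;q)\<^sub>m\<close>, which is even in \<open>m\<close>.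
  The sums of \<open>c\<^sub>m / ((q;q)\<^sub>n\<^sub>-\<^sub>m (q;q)\<^sub>n\<^sub>+\<^sub>m)\<close> over \<open>m\<close> have a closed form, and the
  \<open>q\<close>-Pfaff--Saalschuetz sum turns this Bailey pair into a finite identity with a free bound \<open>L\<close>.
  Tannery's theorem for \<open>L \<rightarrow> \<infinity>\<close> gives the claim for all \<open>x\<close> and \<open>y\<close>; starting from the \<open>q\<close>-Gauss
  sum instead would require \<open>|z| < 1\<close> and an analytic continuation.
\<close>

section \<open>The \<open>q\<close>-Pfaff--Saalschuetz sum\<close>

text \<open>Stated over any commutative ring, so that the algebraic part involves no limits;
  \<open>qpoch_of_nat\<close> identifies it with \<open>qpoch\<close> at nonnegative
  indices.\<close>

definition qpf :: "'a::comm_ring_1 \<Rightarrow> 'a \<Rightarrow> nat \<Rightarrow> 'a" where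
  "qpf q a n = (\<Prod>k<n. 1 - a * q ^ k)"

lemma qpf_0 [simp]: "qpf q a 0 = 1"
  by (simp add: qpf_def)

lemma qpf_Suc: "qpf q a (Suc n) = qpf q a n * (1 - a * q ^ n)"
  by (simp add: qpf_def mult.commute)

lemma qpf_add: "qpf q a (m + n) = qpf q a m * qpf q (a * q ^ m) n"
  by (induction n) (simp_all add: qpf_Suc power_add mult_ac)

text \<open>
  The summand of \<open>\<^sub>3\<phi>\<^sub>2(a, b, q\<^sup>-\<^sup>M; c, abq\<^sup>1\<^sup>-\<^sup>M/c; q, q)\<close> times \<open>(c/ab;q)\<^sub>M / (q;q)\<^sub>M\<close>, with \<open>z = c/(ab)\<close>
  as the parameter, so that no division by \<open>a\<close> or \<open>b\<close> occurs.
\<close>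

definition saal_term :: "'a::field \<Rightarrow> 'a \<Rightarrow> 'a \<Rightarrow> 'a \<Rightarrow> nat \<Rightarrow> nat \<Rightarrow> 'a" where
  "saal_term q a b z M k = qpf q a k * qpf q b k * z ^ k * qpf q z (M - k)
     / (qpf q q k * qpf q (z * a * b) k * qpf q q (M - k))"

text \<open>A creative-telescoping certificate: the first-order recurrence in \<open>M\<close>
  expected of the sum holds for the summands up to a difference of \<open>G\<close>. The factor
  \<open>q\<close> on the left and \<open>q - z * a * b * q ^ k\<close> in \<open>G\<close> avoid
  the exponent \<open>k - 1\<close>, negative at \<open>k = 0\<close>.\<close>

lemma saal_term_certificate:
  fixes q a b z :: "'a::field"
  assumes q: "\<And>k. qpf q q k \<noteq> 0" and c: "\<And>k. qpf q (z * a * b) k \<noteq> 0"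
    and "k \<le> M"
  defines "G \<equiv> \<lambda>k. - (q ^ (M + 1 - k)) * (1 - q ^ k) * (q - z * a * b * q ^ k)
                     * saal_term q a b z (M + 1) k"
  shows "q * ((1 - q ^ (M + 1)) * (1 - z * a * b * q ^ M) * saal_term q a b z (M + 1) k
           - (1 - z * a * q ^ M) * (1 - z * b * q ^ M) * saal_term q a b z M k)
         = G (k + 1) - G k"
proof -
  obtain j where M: "M = k + j"
    using \<open>k \<le> M\<close> by (auto simp: le_iff_add)
  define K J where "K = q ^ k" and "J = q ^ j"
  define H where "H = saal_term q a b z M k"
  have nz: "1 - q * J \<noteq> 0" "1 - q * K \<noteq> 0" "1 - z * a * b * K \<noteq> 0"
    using q[of "Suc j"] q[of "Suc k"] c[of "Suc k"] by (auto simp: qpf_Suc K_def J_def)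
  have F1: "saal_term q a b z (M + 1) k * (1 - q * J) = H * (1 - z * J)"
    using nz q[of j] q[of k] c[of k]
    by (simp add: saal_term_def H_def M qpf_Suc J_def K_def Suc_diff_le field_simps)
  have F2: "saal_term q a b z (M + 1) (k + 1) * ((1 - q * K) * (1 - z * a * b * K))
             = H * ((1 - a * K) * (1 - b * K) * z)"
    using nz q[of j] q[of k] c[of k]
    by (simp add: saal_term_def H_def M qpf_Suc J_def K_def mult_ac)
  have G1: "G (k + 1) = - J * q * H * ((1 - a * K) * (1 - b * K) * z)"
  proof -
    have "G (k + 1) = - J * q * (saal_term q a b z (M + 1) (k + 1) * ((1 - q * K) * (1 - z * a * b * K)))"
      by (simp add: G_def M J_def K_def algebra_simps)
    thus ?thesis by (simp only: F2) simp
  qed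
  \<comment> \<open>After multiplication by \<open>1 - q * J\<close> all terms are multiples of
    \<open>H\<close> by \<open>F1\<close> and \<open>F2\<close>, and a polynomial identity in
    \<open>K\<close> and \<open>J\<close> remains.\<close>
  have "(1 - q * J) * (q * ((1 - q ^ (M + 1)) * (1 - z * a * b * q ^ M) * saal_term q a b z (M + 1) k
           - (1 - z * a * q ^ M) * (1 - z * b * q ^ M) * saal_term q a b z M k))
        = q * ((1 - q * K * J) * (1 - z * a * b * K * J) * (saal_term q a b z (M + 1) k * (1 - q * J))
           - (1 - z * a * K * J) * (1 - z * b * K * J) * (1 - q * J) * H)"
    by (simp add: M K_def J_def H_def power_add algebra_simps)
  also have "\<dots> = (1 - q * J) * (- J * q * H * ((1 - a * K) * (1 - b * K) * z))
           + q * J * (1 - K) * (q - z * a * b * K) * (saal_term q a b z (M + 1) k * (1 - q * J))"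
    unfolding F1 by algebra
  also have "\<dots> = (1 - q * J) * (G (k + 1) - G k)"
    unfolding G1 by (simp add: G_def M J_def K_def algebra_simps)
  finally show ?thesis using nz by simp
qed

text \<open>Summing the certificate over \<open>k\<close> gives a first-order recurrence in
  \<open>M\<close>, which the product side satisfies as well.\<close>

theorem q_saalschuetz:
  fixes q a b z :: "'a::field"
  assumes q: "q \<noteq> 0" "\<And>k. qpf q q k \<noteq> 0" and c: "\<And>k. qpf q (z * a * b) k \<noteq> 0"
  shows "(\<Sum>k\<le>M. saal_term q a b z M k)
    = qpf q (z * a) M * qpf q (z * b) M / (qpf q q M * qpf q (z * a * b) M)"
proof (induction M)
  case 0
  show ?case by (simp add: saal_term_def)
next
  case (Suc M)
  define G where "G = (\<lambda>k. - (q ^ (M + 1 - k)) * (1 - q ^ k) * (q - z * a * b * q ^ k)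
                     * saal_term q a b z (M + 1) k)"
  let ?A = "(1 - q ^ (M + 1)) * (1 - z * a * b * q ^ M)"
  let ?B = "(1 - z * a * q ^ M) * (1 - z * b * q ^ M)"
  have "(\<Sum>k\<le>M. q * (?A * saal_term q a b z (M + 1) k - ?B * saal_term q a b z M k))
          = (\<Sum>k\<le>M. G (Suc k) - G k)"
    using saal_term_certificate[OF q(2) c] by (intro sum.cong) (auto simp: G_def)
  also have "\<dots> = G (Suc M) - G 0"
    by (induction M) (simp_all add: algebra_simps)
  \<comment> \<open>\<open>G 0\<close> vanishes through \<open>1 - q ^ 0\<close>, and
    \<open>G (Suc M)\<close> supplies the summand \<open>k = Suc M\<close> that the sum up to
    \<open>M\<close> lacks.\<close>
  also have "\<dots> = - q * ?A * saal_term q a b z (M + 1) (Suc M)"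
    by (simp add: G_def algebra_simps)
  finally have "q * (?A * (\<Sum>k\<le>M. saal_term q a b z (M + 1) k)) + q * ?A * saal_term q a b z (M + 1) (Suc M)
        = q * (?B * (\<Sum>k\<le>M. saal_term q a b z M k))"
    unfolding sum_distrib_left[symmetric] sum_subtractf by (simp add: algebra_simps)
  hence "q * (?A * (\<Sum>k\<le>Suc M. saal_term q a b z (Suc M) k)) = q * (?B * (\<Sum>k\<le>M. saal_term q a b z M k))"
    by (simp add: algebra_simps)
  hence "?A * (\<Sum>k\<le>Suc M. saal_term q a b z (Suc M) k) = ?B * (\<Sum>k\<le>M. saal_term q a b z M k)"
    using q by simp
  moreover have "?A \<noteq> 0"
    using q(2)[of "Suc M"] c[of "Suc M"] by (simp add: qpf_Suc)
  ultimately have "(\<Sum>k\<le>Suc M. saal_term q a b z (Suc M) k) = ?B * (\<Sum>k\<le>M. saal_term q a b z M k) / ?A"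
    by (simp add: field_simps)
  thus ?case
    unfolding Suc.IH by (simp add: qpf_Suc mult_ac)
qed

section \<open>Bailey pairs relative to \<open>a = 1\<close>\<close>

text \<open>The value 0 for \<open>\<bar>r\<bar> > int n\<close> is the convention that
  \<open>1 / (q;q)\<close> vanishes at negative indices; it permits enlarging ranges of
  summation.\<close>

definition bailey_kernel :: "'a::field \<Rightarrow> nat \<Rightarrow> int \<Rightarrow> 'a" where
  "bailey_kernel q n r =
     (if \<bar>r\<bar> \<le> int n then 1 / (qpf q q (nat (int n - r)) * qpf q q (nat (int n + r))) else 0)"

lemma bailey_kernel_minus [simp]: "bailey_kernel q n (- r) = bailey_kernel q n r"
  by (simp add: bailey_kernel_def mult.commute)

lemma bailey_kernel_abs [simp]: "bailey_kernel q n \<bar>r\<bar> = bailey_kernel q n r"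
  by (simp add: abs_if)

text \<open>For \<open>- int n \<le> r < int n\<close> each side cancels one factor of a factorial,
  with the same result. At the two ends, \<open>r = int n\<close> and
  \<open>r = - int n - 1\<close>, a factor \<open>1 - q powi 0\<close> matches the kernel dropping
  to 0.\<close>

lemma bailey_kernel_shift:
  fixes q :: "'a::field"
  assumes q: "q \<noteq> 0" "\<And>k. qpf q q k \<noteq> 0"
  shows "(1 - q powi (int n + r + 1)) * bailey_kernel q n (r + 1)
       = (1 - q powi (int n - r)) * bailey_kernel q n r"
proof -
  consider "\<bar>r\<bar> > int n" "\<bar>r + 1\<bar> > int n" | "r = - int n - 1" | "r = int n" | "- int n \<le> r" "r < int n"
    by linarith
  thus ?thesis
  proof cases
    case 4
    define i where "i = nat (int n + r)"
    define j where "j = nat (int n - r - 1)"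
    have n: "int n + r = int i" "int n - r = int (Suc j)"
            "int n + (r + 1) = int (Suc i)" "int n - (r + 1) = int j" "int n + r + 1 = int (Suc i)"
      using 4 by (auto simp: i_def j_def)
    have nz: "1 - q ^ Suc i \<noteq> 0" "1 - q ^ Suc j \<noteq> 0"
      using q(2)[of "Suc i"] q(2)[of "Suc j"] by (auto simp: qpf_Suc)
    have "bailey_kernel q n (r + 1) = 1 / (qpf q q j * qpf q q (Suc i))"
      unfolding bailey_kernel_def n nat_int using 4 by auto
    moreover have "bailey_kernel q n r = 1 / (qpf q q (Suc j) * qpf q q i)"
      unfolding bailey_kernel_def n nat_int using 4 by auto
    ultimately show ?thesis
      unfolding n(5) unfolding n power_int_of_nat using nz q(2)[of i] q(2)[of j] by (simp add: qpf_Suc)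
  qed (auto simp: bailey_kernel_def)
qed

lemma bailey_kernel_level:
  fixes q :: "'a::field"
  assumes q: "q \<noteq> 0" "\<And>k. qpf q q k \<noteq> 0"
  shows "(1 - q powi (int (Suc n) - r)) * (1 - q powi (int (Suc n) + r)) * bailey_kernel q (Suc n) r
       = bailey_kernel q n r"
proof -
  consider "\<bar>r\<bar> > int n + 1" | "r = - int (Suc n)" | "r = int (Suc n)" | "\<bar>r\<bar> \<le> int n"
    by linarith
  thus ?thesis
  proof cases
    case 4
    define i where "i = nat (int n + r)"
    define j where "j = nat (int n - r)"
    have n: "int n + r = int i" "int n - r = int j"
            "int (Suc n) + r = int (Suc i)" "int (Suc n) - r = int (Suc j)"
      using 4 by (auto simp: i_def j_def)
    have nz: "1 - q ^ Suc i \<noteq> 0" "1 - q ^ Suc j \<noteq> 0"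
      using q(2)[of "Suc i"] q(2)[of "Suc j"] by (auto simp: qpf_Suc)
    have "bailey_kernel q (Suc n) r = 1 / (qpf q q (Suc j) * qpf q q (Suc i))"
      unfolding bailey_kernel_def n nat_int using 4 by auto
    moreover have "bailey_kernel q n r = 1 / (qpf q q j * qpf q q i)"
      unfolding bailey_kernel_def n nat_int using 4 by auto
    ultimately show ?thesis
      unfolding n power_int_of_nat using nz q(2)[of i] q(2)[of j] by (simp add: qpf_Suc)
  qed (auto simp: bailey_kernel_def)
qed

text \<open>The beta side of the Bailey pair relative to \<open>a = 1\<close> whose alpha side is
  \<open>c 0\<close> at 0 and \<open>c r + c (- r)\<close> at \<open>r > 0\<close>.\<close>

definition bailey_sum :: "'a::field \<Rightarrow> nat \<Rightarrow> (int \<Rightarrow> 'a) \<Rightarrow> 'a" where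
  "bailey_sum q n c = (\<Sum>r\<in>{- int n..int n}. c r * bailey_kernel q n r)"

lemma bailey_sum_add: "bailey_sum q n (\<lambda>r. c r + d r) = bailey_sum q n c + bailey_sum q n d"
  by (simp add: bailey_sum_def sum.distrib distrib_right)

lemma bailey_sum_diff: "bailey_sum q n (\<lambda>r. c r - d r) = bailey_sum q n c - bailey_sum q n d"
  by (simp add: bailey_sum_def sum_subtractf left_diff_distrib)

lemma bailey_sum_cmult: "bailey_sum q n (\<lambda>r. a * c r) = a * bailey_sum q n c"
  by (simp add: bailey_sum_def sum_distrib_left mult.assoc)

lemma bailey_sum_mono_neutral:
  assumes "n \<le> m"
  shows "(\<Sum>r\<in>{- int m..int m}. c r * bailey_kernel q n r) = bailey_sum q n c"
  unfolding bailey_sum_def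
  by (rule sum.mono_neutral_right) (use assms in \<open>auto simp: bailey_kernel_def\<close>)

lemma bailey_sum_reflect: "bailey_sum q n (\<lambda>r. c (- r)) = bailey_sum q n c"
  unfolding bailey_sum_def
  by (rule sum.reindex_bij_witness[of _ uminus uminus]) auto

text \<open>Translating \<open>r\<close> by 1 moves the kernel relation
  \<open>bailey_kernel_shift\<close> onto the coefficients.\<close>

lemma bailey_sum_shift:
  fixes q :: "'a::field"
  assumes q: "q \<noteq> 0" "\<And>k. qpf q q k \<noteq> 0"
  shows "bailey_sum q n (\<lambda>r. (1 - q powi (int n + r)) * c (r - 1))
       = bailey_sum q n (\<lambda>r. (1 - q powi (int n - r)) * c r)"
proof -
  have "bailey_sum q n (\<lambda>r. (1 - q powi (int n - r)) * c r)
      = (\<Sum>r\<in>{- int n..int n}. c r * ((1 - q powi (int n + r + 1)) * bailey_kernel q n (r + 1)))"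
    unfolding bailey_sum_def bailey_kernel_shift[OF q] by (simp add: mult_ac)
  also have "\<dots> = (\<Sum>r\<in>{- int n + 1..int n + 1}. c (r - 1) * ((1 - q powi (int n + r)) * bailey_kernel q n r))"
    by (rule sum.reindex_bij_witness[of _ "\<lambda>r. r - 1" "\<lambda>r. r + 1"]) (auto simp: add_ac)
  \<comment> \<open>The translated range may be moved back: the kernel vanishes at
    \<open>int n + 1\<close>, and the factor \<open>1 - q powi 0\<close> at
    \<open>- int n\<close>.\<close>
  also have "\<dots> = (\<Sum>r\<in>{- int n..int n}. c (r - 1) * ((1 - q powi (int n + r)) * bailey_kernel q n r))"
  proof (rule sum.mono_neutral_cong)
    fix r assume "r \<in> {- int n..int n} - {- int n + 1..int n + 1}"
    hence "r = - int n" by auto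
    thus "c (r - 1) * ((1 - q powi (int n + r)) * bailey_kernel q n r) = 0" by simp
  qed (auto simp: bailey_kernel_def)
  finally show ?thesis
    by (simp add: bailey_sum_def mult_ac)
qed

text \<open>Passing from \<open>n\<close> to \<open>Suc n\<close> only changes the coefficients;
  this is the source of recurrences in \<open>n\<close>.\<close>

lemma bailey_sum_level:
  fixes q :: "'a::field"
  assumes q: "q \<noteq> 0" "\<And>k. qpf q q k \<noteq> 0"
  shows "bailey_sum q (Suc n) (\<lambda>r. (1 - q powi (int (Suc n) - r)) * (1 - q powi (int (Suc n) + r)) * c r)
       = bailey_sum q n c"
proof -
  have "bailey_sum q n c = (\<Sum>r\<in>{- int (Suc n)..int (Suc n)}. c r * bailey_kernel q n r)"
    by (rule bailey_sum_mono_neutral[symmetric]) simp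
  also have "\<dots> = bailey_sum q (Suc n) (\<lambda>r. (1 - q powi (int (Suc n) - r)) * (1 - q powi (int (Suc n) + r)) * c r)"
    unfolding bailey_sum_def bailey_kernel_level[OF q, where n = n, symmetric] by (simp add: mult_ac)
  finally show ?thesis by simp
qed

section \<open>A Bailey pair modulo 3\<close>

definition chi3 :: "int \<Rightarrow> 'a::comm_ring_1" where
  "chi3 r = (if r mod 3 = 0 then 0 else if r mod 3 = 1 then 1 else - 1)"

lemma chi3_minus: "chi3 (- r) = - chi3 r"
proof -
  have "(- r) mod 3 = (if r mod 3 = 0 then 0 else 3 - r mod 3)"
    by presburger
  moreover have "r mod 3 = 0 \<or> r mod 3 = 1 \<or> r mod 3 = 2"
    by presburger
  ultimately show ?thesis by (auto simp: chi3_def)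
qed

text \<open>Periodicity, in the one instance that identifies the Gaussian sums with
  \<open>j = - 2\<close> and \<open>j = 1\<close>.\<close>

lemma chi3_minus_2: "chi3 (r - 2) = chi3 (r + 1)"
proof -
  have "(r - 2) mod 3 = (r + 1) mod 3" by presburger
  thus ?thesis by (simp add: chi3_def)
qed

text \<open>
  With \<open>q = p\<^sup>3\<close> all Gaussian exponents are integers. The shift relation \<open>gauss_sum_rel\<close> and the
  reflection \<open>r \<mapsto> -r\<close> connect finitely many of these sums; eliminating all but \<open>(j,k) = (-1,-2)\<close>
  from them and \<open>gauss_sum_level\<close> leaves a first-order recurrence in \<open>n\<close>.
\<close>

definition gauss_sum :: "'a::field \<Rightarrow> nat \<Rightarrow> int \<Rightarrow> int \<Rightarrow> 'a" where
  "gauss_sum p n j k = bailey_sum (p ^ 3) n (\<lambda>r. chi3 (r + j) * p powi (r\<^sup>2 + k * r))"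

lemma gauss_sum_minus: "gauss_sum p n j k = - gauss_sum p n (- j) (- k)"
proof -
  have "gauss_sum p n j k = bailey_sum (p ^ 3) n (\<lambda>r. chi3 (- r + j) * p powi ((- r)\<^sup>2 + k * (- r)))"
    unfolding gauss_sum_def by (rule bailey_sum_reflect[symmetric])
  also have "\<dots> = bailey_sum (p ^ 3) n (\<lambda>r. (- 1) * (chi3 (r - j) * p powi (r\<^sup>2 - k * r)))"
  proof -
    have "chi3 (- r + j) = - (chi3 (r - j) :: 'a)" for r
      using chi3_minus[of "r - j"] by simp
    thus ?thesis by simp
  qed
  finally show ?thesis
    unfolding bailey_sum_cmult gauss_sum_def by simp
qed

context
  fixes p :: "'a::field_char_0"
  assumes p: "p \<noteq> 0" "\<And>k. qpf (p ^ 3) (p ^ 3) k \<noteq> 0"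
begin

text \<open>This is \<open>bailey_sum_shift\<close> for a Gaussian:
  \<open>(r - 1)\<^sup>2 + k * (r - 1)\<close> equals
  \<open>r\<^sup>2 + (k - 2) * r + (1 - k)\<close>, and a factor \<open>p powi (3 * r)\<close> or
  its inverse moves \<open>k\<close> by 3.\<close>

lemma gauss_sum_rel:
  "p powi (1 - k) * (gauss_sum p n (j - 1) (k - 2) - p ^ (3 * n) * gauss_sum p n (j - 1) (k + 1))
   = gauss_sum p n j k - p ^ (3 * n) * gauss_sum p n j (k - 3)"
proof -
  define c where "c = (\<lambda>r::int. chi3 (r + j) * p powi (r\<^sup>2 + k * r))"
  have pw: "(p ^ 3) powi m = p powi (3 * m)" for m
    using power_int_mult[of p 3 m] by simp
  have add: "p powi a * p powi b = p powi (a + b)" for a b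
    using p by (simp add: power_int_add)
  have n: "p ^ (3 * n) = p powi (3 * int n)"
    by (simp flip: power_int_of_nat)
  have "p powi (1 - k) * (gauss_sum p n (j - 1) (k - 2) - p ^ (3 * n) * gauss_sum p n (j - 1) (k + 1))
     = bailey_sum (p ^ 3) n (\<lambda>r. (1 - (p ^ 3) powi (int n + r)) * c (r - 1))"
    unfolding gauss_sum_def bailey_sum_diff[symmetric] bailey_sum_cmult[symmetric]
  proof (rule arg_cong[where f = "bailey_sum _ _"], rule ext)
    fix r :: int
    have "p powi (1 - k) * (chi3 (r + (j - 1)) * p powi (r\<^sup>2 + (k - 2) * r)
             - p ^ (3 * n) * (chi3 (r + (j - 1)) * p powi (r\<^sup>2 + (k + 1) * r)))
        = chi3 (r - 1 + j) * (p powi (1 - k) * p powi (r\<^sup>2 + (k - 2) * r)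
             - p powi (1 - k) * (p powi (3 * int n) * p powi (r\<^sup>2 + (k + 1) * r)))"
      unfolding n by (simp add: algebra_simps)
    also have "\<dots> = chi3 (r - 1 + j) * (p powi ((r - 1)\<^sup>2 + k * (r - 1))
             - p powi (3 * (int n + r)) * p powi ((r - 1)\<^sup>2 + k * (r - 1)))"
      unfolding add by (simp add: algebra_simps power2_eq_square)
    also have "\<dots> = (1 - (p ^ 3) powi (int n + r)) * c (r - 1)"
      by (simp add: c_def pw algebra_simps)
    finally show "p powi (1 - k) * (chi3 (r + (j - 1)) * p powi (r\<^sup>2 + (k - 2) * r)
             - p ^ (3 * n) * (chi3 (r + (j - 1)) * p powi (r\<^sup>2 + (k + 1) * r)))
        = (1 - (p ^ 3) powi (int n + r)) * c (r - 1)" .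
  qed
  also have "\<dots> = bailey_sum (p ^ 3) n (\<lambda>r. (1 - (p ^ 3) powi (int n - r)) * c r)"
    by (rule bailey_sum_shift) (use p in auto)
  also have "\<dots> = gauss_sum p n j k - p ^ (3 * n) * gauss_sum p n j (k - 3)"
    unfolding gauss_sum_def bailey_sum_diff[symmetric] bailey_sum_cmult[symmetric]
  proof (rule arg_cong[where f = "bailey_sum _ _"], rule ext)
    fix r :: int
    have "(1 - (p ^ 3) powi (int n - r)) * c r
        = chi3 (r + j) * (p powi (r\<^sup>2 + k * r) - p powi (3 * (int n - r)) * p powi (r\<^sup>2 + k * r))"
      by (simp add: c_def pw algebra_simps)
    also have "\<dots> = chi3 (r + j) * (p powi (r\<^sup>2 + k * r) - p powi (3 * int n) * p powi (r\<^sup>2 + (k - 3) * r))"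
      unfolding add by (simp add: algebra_simps)
    finally show "(1 - (p ^ 3) powi (int n - r)) * c r
       = chi3 (r + j) * p powi (r\<^sup>2 + k * r) - p ^ (3 * n) * (chi3 (r + j) * p powi (r\<^sup>2 + (k - 3) * r))"
      unfolding n by (simp add: algebra_simps)
  qed
  finally show ?thesis .
qed

text \<open>With \<open>N = Suc n\<close>, the two factors of \<open>bailey_sum_level\<close> expand
  to \<open>1 + q^(2N) - q^N (q^r + q^(-r))\<close>; the powers of \<open>q^r = p^(3r)\<close> move
  \<open>k\<close> by 3 in either direction.\<close>

lemma gauss_sum_level:
  "gauss_sum p n j k = (1 + (p ^ (3 * Suc n))\<^sup>2) * gauss_sum p (Suc n) j k
     - p ^ (3 * Suc n) * (gauss_sum p (Suc n) j (k + 3) + gauss_sum p (Suc n) j (k - 3))"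
proof -
  define c where "c = (\<lambda>r::int. chi3 (r + j) * p powi (r\<^sup>2 + k * r))"
  define N where "N = Suc n"
  have pw: "(p ^ 3) powi m = p powi (3 * m)" for m
    using power_int_mult[of p 3 m] by simp
  have add: "p powi a * p powi b = p powi (a + b)" for a b
    using p by (simp add: power_int_add)
  have n: "p ^ (3 * N) = p powi (3 * int N)"
    by (simp flip: power_int_of_nat)
  have "gauss_sum p n j k = bailey_sum (p ^ 3) N
     (\<lambda>r. (1 - (p ^ 3) powi (int N - r)) * (1 - (p ^ 3) powi (int N + r)) * c r)"
    unfolding gauss_sum_def N_def c_def by (rule bailey_sum_level[symmetric]) (use p in auto)
  also have "\<dots> = (1 + (p ^ (3 * N))\<^sup>2) * gauss_sum p N j k
     - p ^ (3 * N) * (gauss_sum p N j (k + 3) + gauss_sum p N j (k - 3))"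
    unfolding gauss_sum_def bailey_sum_diff[symmetric] bailey_sum_cmult[symmetric]
      bailey_sum_add[symmetric]
  proof (rule arg_cong[where f = "bailey_sum _ _"], rule ext)
    fix r :: int
    have e: "p powi (3 * (int N - r)) = p powi (3 * int N) * p powi (- 3 * r)"
            "p powi (3 * (int N + r)) = p powi (3 * int N) * p powi (3 * r)"
            "p powi (r\<^sup>2 + (k + 3) * r) = p powi (r\<^sup>2 + k * r) * p powi (3 * r)"
            "p powi (r\<^sup>2 + (k - 3) * r) = p powi (r\<^sup>2 + k * r) * p powi (- 3 * r)"
      unfolding add by (simp_all add: algebra_simps)
    have i: "p powi (- 3 * r) * p powi (3 * r) = 1"
      unfolding add by simp
    have "(1 - P * b) * (1 - P * a) * (x * g) = (1 + P\<^sup>2) * (x * g) - P * (x * (g * a) + x * (g * b))"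
      if "b * a = 1" for P a b x g :: 'a
      using that by algebra
    from this[OF i]
    show "(1 - (p ^ 3) powi (int N - r)) * (1 - (p ^ 3) powi (int N + r)) * c r
      = (1 + (p ^ (3 * N))\<^sup>2) * (chi3 (r + j) * p powi (r\<^sup>2 + k * r))
         - p ^ (3 * N) * (chi3 (r + j) * p powi (r\<^sup>2 + (k + 3) * r)
            + chi3 (r + j) * p powi (r\<^sup>2 + (k - 3) * r))"
      unfolding pw n c_def e .
  qed
  finally show ?thesis by (simp add: N_def)
qed

text \<open>Besides \<open>X\<close>, the sums at \<open>(j,k) = (1,-1)\<close>,
  \<open>(0,-3)\<close>, \<open>(1,-4)\<close> and \<open>(-1,-5)\<close> enter. Four instances of
  \<open>gauss_sum_rel\<close> (the facts \<open>W\<close>, \<open>D\<close>, \<open>Z\<close>,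
  \<open>Y\<close>) express them through \<open>X\<close>, and one instance of
  \<open>gauss_sum_level\<close> then closes the recurrence.\<close>

lemma gauss_sum_elim:
  defines "X \<equiv> \<lambda>n. gauss_sum p n (- 1) (- 2)"
  shows "p ^ (3 * n) * gauss_sum p n 0 (- 3) = - p * (1 - p ^ (6 * n)) * X n"
    and "(1 - p ^ (6 * n + 6)) * (1 - p ^ (6 * n + 3)) * X (Suc n) = p ^ (6 * n) * X n"
proof -
  have per: "gauss_sum p n (- 2) k = gauss_sum p n 1 k" for k n
    unfolding gauss_sum_def by (simp only: add_uminus_conv_diff chi3_minus_2)
  have Xe: "gauss_sum p n (- 1) (- 2) = X n" for n
    by (simp add: X_def)
  have half: "a = 0" if "a + a = 0" for a :: 'a
    using that by (simp flip: mult_2)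
  \<comment> \<open>The reflection maps this sum to its own negative.\<close>
  have z: "gauss_sum p n 0 0 = 0" for n
    by (rule half[OF iffD1[OF eq_neg_iff_add_eq_0 gauss_sum_minus[of p n 0 0, unfolded minus_zero]]])
  have m1: "gauss_sum p n (- 1) 1 = - gauss_sum p n 1 (- 1)" for n
    using gauss_sum_minus[of p n "- 1" 1] by simp
  have m2: "gauss_sum p n 1 2 = - X n" for n
    using gauss_sum_minus[of p n 1 2] by (simp add: X_def)
  have W: "gauss_sum p n 1 (- 1) = - (p ^ (3 * n)) * X n" for n
  proof -
    \<comment> \<open>For \<open>j = - 1\<close>, \<open>k = 1\<close>, periodicity and reflection
      turn the right side of the shift relation into the negative of its left side.\<close>
    have "gauss_sum p n 1 (- 1) + p ^ (3 * n) * X n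
            = - (gauss_sum p n 1 (- 1) + p ^ (3 * n) * X n)"
      using gauss_sum_rel[of 1 n "- 1"] by (simp add: per m1 m2 Xe)
    hence "gauss_sum p n 1 (- 1) + p ^ (3 * n) * X n = 0"
      by (rule half[OF iffD1[OF eq_neg_iff_add_eq_0]])
    hence "gauss_sum p n 1 (- 1) = - (p ^ (3 * n) * X n)"
      by (rule iffD2[OF eq_neg_iff_add_eq_0])
    thus ?thesis by simp
  qed
  have D: "p ^ (3 * n) * gauss_sum p n 0 (- 3) = - p * X n + (p ^ (3 * n))\<^sup>2 * p * X n" for n
    using gauss_sum_rel[of 0 n 0]
    by (simp add: z m1 W Xe algebra_simps power2_eq_square)
  have Y: "p ^ (3 * n) * gauss_sum p n (- 1) (- 5)
       = - ((p ^ (3 * n))\<^sup>2) * p ^ 3 * X n - p ^ 3 * gauss_sum p n 1 (- 4) + X n" for n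
    using gauss_sum_rel[of "- 2" n "- 1"]
    by (simp add: per W Xe algebra_simps power2_eq_square)
  have Z: "p ^ (3 * n) * gauss_sum p n 1 (- 4) = - (p\<^sup>2) * gauss_sum p n 0 (- 3) - p ^ (3 * n) * X n" for n
  proof -
    have "p\<^sup>2 * gauss_sum p n 0 (- 3) = - (p ^ (3 * n) * X n) - p ^ (3 * n) * gauss_sum p n 1 (- 4)"
      using gauss_sum_rel[of "- 1" n 1] by (simp add: z W)
    moreover have "b = - a - c" if "a = - c - b" for a b c :: 'a
      using that by simp
    ultimately have "p ^ (3 * n) * gauss_sum p n 1 (- 4) = - (p\<^sup>2 * gauss_sum p n 0 (- 3)) - p ^ (3 * n) * X n"
      by blast
    thus ?thesis by simp
  qed
  have Q2: "(p ^ (3 * n))\<^sup>2 = p ^ (6 * n)" for n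
    using power_mult[of p "3 * n" 2] by (simp add: mult.commute)
  show "p ^ (3 * n) * gauss_sum p n 0 (- 3) = - p * (1 - p ^ (6 * n)) * X n"
    unfolding D Q2 by (simp add: algebra_simps)
  define Q where "Q = p ^ (3 * Suc n)"
  define P where "P = p ^ (6 * n)"
  have QP: "Q\<^sup>2 = P * p ^ 6"
    unfolding Q_def P_def Q2 by (simp add: power_add mult.commute)
  \<comment> \<open>The sum at \<open>(-1,1)\<close> is known from \<open>m1\<close> and
    \<open>W\<close>, so only the one at \<open>(-1,-5)\<close> is left to be removed, by
    \<open>Y\<close>, then \<open>Z\<close>, then \<open>D\<close>.\<close>
  have L: "X n = (1 + Q\<^sup>2) * X (Suc n) - Q * (Q * X (Suc n) + gauss_sum p (Suc n) (- 1) (- 5))"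
    using gauss_sum_level[of n "- 1" "- 2"] W[of "Suc n"] unfolding Q_def[symmetric]
    by (simp add: Xe m1)
  have "X n = X (Suc n) - Q * gauss_sum p (Suc n) (- 1) (- 5)"
    unfolding L by (simp add: algebra_simps power2_eq_square)
  also have "\<dots> = Q\<^sup>2 * p ^ 3 * X (Suc n) + p ^ 3 * gauss_sum p (Suc n) 1 (- 4)"
    using Y[of "Suc n"] unfolding Q_def[symmetric] by simp
  \<comment> \<open>The factor \<open>Q\<^sup>2\<close> is needed because \<open>Z\<close> and
    \<open>D\<close> each determine their sum only after multiplication by \<open>Q\<close>.\<close>
  finally have "Q\<^sup>2 * X n = Q\<^sup>2 * (Q\<^sup>2 * p ^ 3 * X (Suc n))
                  + p ^ 3 * Q * (Q * gauss_sum p (Suc n) 1 (- 4))"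
    by (simp add: algebra_simps power2_eq_square)
  also have "Q * gauss_sum p (Suc n) 1 (- 4) = - (p\<^sup>2) * gauss_sum p (Suc n) 0 (- 3) - Q * X (Suc n)"
    using Z[of "Suc n"] unfolding Q_def[symmetric] .
  also have "p ^ 3 * Q * \<dots> = - (p ^ 5) * (Q * gauss_sum p (Suc n) 0 (- 3)) - p ^ 3 * Q\<^sup>2 * X (Suc n)"
    by (simp add: algebra_simps power2_eq_square eval_nat_numeral)
  also have "Q * gauss_sum p (Suc n) 0 (- 3) = - p * X (Suc n) + Q\<^sup>2 * p * X (Suc n)"
    using D[of "Suc n"] unfolding Q_def[symmetric] .
  finally have "p ^ 6 * ((1 - Q\<^sup>2) * (1 - P * p ^ 3) * X (Suc n)) = p ^ 6 * (P * X n)"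
    unfolding QP by (simp add: algebra_simps eval_nat_numeral)
  hence "(1 - Q\<^sup>2) * (1 - P * p ^ 3) * X (Suc n) = P * X n"
    using p by simp
  thus "(1 - p ^ (6 * n + 6)) * (1 - p ^ (6 * n + 3)) * X (Suc n) = p ^ (6 * n) * X n"
    unfolding QP by (simp add: P_def power_add)
qed

text \<open>In terms of \<open>q = p^3\<close> the value is
  \<open>- q^(n^2 - n) / (q;q)_(2n)\<close>. It solves the recurrence because \<open>A\<close> holds
  the last two factors of the next factorial; the sign is \<open>chi3 (- 1)\<close> at
  \<open>n = 0\<close>.\<close>

lemma gauss_sum_closed:
  "gauss_sum p n (- 1) (- 2) = - (p ^ (3 * n\<^sup>2)) / (p ^ (3 * n) * qpf (p ^ 3) (p ^ 3) (2 * n))"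
proof (induction n)
  case 0
  show ?case
    by (simp add: gauss_sum_def bailey_sum_def bailey_kernel_def chi3_def)
next
  case (Suc n)
  define A where "A = (1 - p ^ (6 * n + 6)) * (1 - p ^ (6 * n + 3))"
  have qpf: "qpf (p ^ 3) (p ^ 3) (2 * Suc n) = qpf (p ^ 3) (p ^ 3) (2 * n) * A"
  proof -
    have "p ^ 3 * (p ^ 3) ^ (2 * n) = p ^ (6 * n + 3)" "p ^ 3 * (p ^ 3) ^ Suc (2 * n) = p ^ (6 * n + 6)"
      unfolding power_mult[symmetric] power_add[symmetric] by (simp_all add: add.commute)
    moreover have "2 * Suc n = Suc (Suc (2 * n))" by simp
    ultimately show ?thesis
      by (simp only: qpf_Suc A_def mult_ac)
  qed
  hence "A \<noteq> 0"
    using p(2)[of "2 * Suc n"] by auto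
  hence "gauss_sum p (Suc n) (- 1) (- 2) = p ^ (6 * n) * gauss_sum p n (- 1) (- 2) / A"
    using gauss_sum_elim(2)[of n] by (simp add: A_def field_simps)
  also have "\<dots> = - (p ^ (3 * (Suc n)\<^sup>2)) / (p ^ (3 * Suc n) * (qpf (p ^ 3) (p ^ 3) (2 * n) * A))"
  proof -
    have "3 * (Suc n)\<^sup>2 = 3 * n\<^sup>2 + 6 * n + 3" by (simp add: power2_eq_square)
    thus ?thesis
      unfolding Suc.IH using p \<open>A \<noteq> 0\<close> by (simp add: field_simps power_add)
  qed
  finally show ?case unfolding qpf .
qed

text \<open>For \<open>n > 0\<close> the value is \<open>p q^(n^2 - 2n) / (q;q)_(2n-1)\<close>, and
  for \<open>n = 0\<close> it is 0, which is why the series of the theorem starts at 1. The shift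
  \<open>k = - 3\<close> anticipates the factor \<open>q^r\<close> in \<open>z^r\<close>.\<close>

lemma gauss_sum_bailey_pair:
  "gauss_sum p n 0 (- 3)
     = p * p ^ (3 * n\<^sup>2) * (1 - p ^ (6 * n)) / (p ^ (6 * n) * qpf (p ^ 3) (p ^ 3) (2 * n))"
proof -
  have "gauss_sum p n 0 (- 3) = - p * (1 - p ^ (6 * n)) * gauss_sum p n (- 1) (- 2) / p ^ (3 * n)"
    using gauss_sum_elim(1)[of n] p by (simp add: field_simps)
  moreover have "p ^ (6 * n) = p ^ (3 * n) * p ^ (3 * n)"
    by (simp flip: power_add)
  ultimately show ?thesis
    unfolding gauss_sum_closed by (simp add: mult_ac)
qed

end

section \<open>The Bailey lemma\<close>

definition bailey_weight :: "'a::field \<Rightarrow> 'a \<Rightarrow> 'a \<Rightarrow> 'a \<Rightarrow> nat \<Rightarrow> 'a" where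
  "bailey_weight q x y z r = qpf q x r * qpf q y r * z ^ r / (qpf q (z * x) r * qpf q (z * y) r)"

text \<open>Only \<open>n \<ge> r\<close> contribute. With \<open>n = r + k\<close> every factorial
  splits at \<open>r\<close>, and the \<open>q\<close>-Saalschuetz sum with parameters
  \<open>x q^r\<close> and \<open>y q^r\<close> remains; its \<open>z * a * b\<close> is
  \<open>q^(2r+1)\<close>, the base of the tail of \<open>(q;q)_(2r+k)\<close>.\<close>

lemma bailey_kernel_sum:
  fixes q x y z :: "'a::field"
  assumes q: "q \<noteq> 0" "\<And>k. qpf q q k \<noteq> 0" and z: "z * x * y = q"
    and nz: "qpf q (z * x) r \<noteq> 0" "qpf q (z * y) r \<noteq> 0" and "r \<le> L"
  shows "(\<Sum>n\<le>L. qpf q x n * qpf q y n * z ^ n * (qpf q z (L - n) / qpf q q (L - n))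
            * bailey_kernel q n (int r))
       = qpf q (z * x) L * qpf q (z * y) L * bailey_weight q x y z r * bailey_kernel q L (int r)"
proof -
  obtain M where L: "L = r + M"
    using \<open>r \<le> L\<close> by (auto simp: le_iff_add)
  define a b where "a = x * q ^ r" and "b = y * q ^ r"
  have zab: "z * a * b = q * q ^ (2 * r)"
  proof -
    have "z * a * b = z * x * y * (q ^ r * q ^ r)"
      by (simp add: a_def b_def mult_ac)
    thus ?thesis unfolding z mult_2 power_add .
  qed
  have q2: "qpf q q (2 * r + k) = qpf q q (2 * r) * qpf q (z * a * b) k" for k
    unfolding zab by (rule qpf_add)
  have c: "qpf q (z * a * b) k \<noteq> 0" for k
    using q(2)[of "2 * r + k"] by (auto simp: q2)
  have K: "bailey_kernel q (r + k) (int r) = 1 / (qpf q q k * (qpf q q (2 * r) * qpf q (z * a * b) k))" for k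
  proof -
    have "int (r + k) - int r = int k" "int (r + k) + int r = int (2 * r + k)"
      by simp_all
    thus ?thesis
      unfolding bailey_kernel_def by (simp only: nat_int q2) simp
  qed
  define C where "C = qpf q x r * qpf q y r * z ^ r / qpf q q (2 * r)"
  have "(\<Sum>n\<le>L. qpf q x n * qpf q y n * z ^ n * (qpf q z (L - n) / qpf q q (L - n))
            * bailey_kernel q n (int r))
      = (\<Sum>n\<in>{r..L}. qpf q x n * qpf q y n * z ^ n * (qpf q z (L - n) / qpf q q (L - n))
            * bailey_kernel q n (int r))"
    by (rule sum.mono_neutral_right) (auto simp: bailey_kernel_def)
  also have "\<dots> = (\<Sum>k\<le>M. C * saal_term q a b z M k)"
  proof (rule sum.reindex_bij_witness[of _ "\<lambda>k. r + k" "\<lambda>n. n - r"])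
    fix n assume n: "n \<in> {r..L}"
    define k where "k = n - r"
    have "n = r + k" using n by (simp add: k_def)
    thus "C * saal_term q a b z M (n - r) = qpf q x n * qpf q y n * z ^ n
             * (qpf q z (L - n) / qpf q q (L - n)) * bailey_kernel q n (int r)"
      by (simp add: K qpf_add C_def saal_term_def L power_add mult_ac flip: a_def b_def)
  qed (auto simp: L)
  also have "\<dots> = C * (qpf q (z * a) M * qpf q (z * b) M / (qpf q q M * qpf q (z * a * b) M))"
    by (simp only: q_saalschuetz[OF q c] flip: sum_distrib_left)
  also have "\<dots> = qpf q (z * x) L * qpf q (z * y) L * bailey_weight q x y z r * bailey_kernel q L (int r)"
    using nz by (simp add: L K qpf_add C_def bailey_weight_def a_def b_def mult_ac)
  finally show ?thesis .
qed

text \<open>Interchange of the two sums, after extending all inner ranges to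
  \<open>- int L..int L\<close>; the kernel being even, \<open>bailey_kernel_sum\<close> at
  \<open>nat \<bar>r\<bar>\<close> evaluates the inner sum.\<close>

lemma bailey_lemma_finite:
  fixes q x y z :: "'a::field"
  assumes q: "q \<noteq> 0" "\<And>k. qpf q q k \<noteq> 0" and z: "z * x * y = q"
    and nz: "\<And>k. qpf q (z * x) k \<noteq> 0" "\<And>k. qpf q (z * y) k \<noteq> 0"
  shows "(\<Sum>n\<le>L. qpf q x n * qpf q y n * z ^ n * bailey_sum q n c * (qpf q z (L - n) / qpf q q (L - n)))
       = qpf q (z * x) L * qpf q (z * y) L * bailey_sum q L (\<lambda>r. bailey_weight q x y z (nat \<bar>r\<bar>) * c r)"
proof -
  define A where "A = (\<lambda>n. qpf q x n * qpf q y n * z ^ n * (qpf q z (L - n) / qpf q q (L - n)))"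
  have "(\<Sum>n\<le>L. qpf q x n * qpf q y n * z ^ n * bailey_sum q n c * (qpf q z (L - n) / qpf q q (L - n)))
      = (\<Sum>n\<le>L. A n * (\<Sum>r\<in>{- int L..int L}. c r * bailey_kernel q n r))"
    by (intro sum.cong) (auto simp: A_def bailey_sum_mono_neutral)
  also have "\<dots> = (\<Sum>r\<in>{- int L..int L}. c r * (\<Sum>n\<le>L. A n * bailey_kernel q n r))"
    unfolding sum_distrib_left by (subst sum.swap) (simp add: mult_ac)
  also have "\<dots> = (\<Sum>r\<in>{- int L..int L}. c r * (qpf q (z * x) L * qpf q (z * y) L
       * bailey_weight q x y z (nat \<bar>r\<bar>) * bailey_kernel q L r))"
  proof (rule sum.cong)
    fix r assume "r \<in> {- int L..int L}"
    hence "nat \<bar>r\<bar> \<le> L" by auto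
    from bailey_kernel_sum[OF q z nz this]
    show "c r * (\<Sum>n\<le>L. A n * bailey_kernel q n r) = c r * (qpf q (z * x) L * qpf q (z * y) L
       * bailey_weight q x y z (nat \<bar>r\<bar>) * bailey_kernel q L r)"
      by (simp add: A_def)
  qed simp
  finally show ?thesis
    by (simp add: bailey_sum_def sum_distrib_left mult_ac)
qed

section \<open>Interchange of limits and sums\<close>

lemma tannery_bounded:
  fixes f :: "nat \<Rightarrow> 'a::{real_normed_algebra, banach}"
  assumes f: "summable (\<lambda>n. norm (f n))"
    and bound: "\<And>n L. n \<le> L \<Longrightarrow> norm (g n L) \<le> C"
    and lim: "\<And>n. g n \<longlonglongrightarrow> w"
  shows "(\<lambda>L. \<Sum>n\<le>L. f n * g n L) \<longlonglongrightarrow> suminf f * w"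
proof -
  define a where "a = (\<lambda>n L. if n \<le> L then f n * g n L else 0)"
  have "norm (g 0 0) \<le> C" by (rule bound) simp
  hence C: "C \<ge> 0" by (rule order_trans[OF norm_ge_zero])
  have "(\<lambda>L. suminf (\<lambda>n. a n L)) \<longlonglongrightarrow> (\<Sum>n. f n * w)"
  proof (rule tannerys_theorem[THEN conjunct2, THEN conjunct2])
    show "(\<lambda>L. a n L) \<longlonglongrightarrow> f n * w" for n
    proof (rule Lim_transform_eventually)
      show "(\<lambda>L. f n * g n L) \<longlonglongrightarrow> f n * w"
        by (intro tendsto_intros lim)
      show "eventually (\<lambda>L. f n * g n L = a n L) sequentially"
        using eventually_ge_at_top[of n] by eventually_elim (simp add: a_def)
    qed
    have "norm (a n L) \<le> norm (f n) * C" for n L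
    proof (cases "n \<le> L")
      case True
      have "norm (f n * g n L) \<le> norm (f n) * norm (g n L)"
        by (rule norm_mult_ineq)
      also have "\<dots> \<le> norm (f n) * C"
        using bound[OF True] by (intro mult_left_mono) auto
      finally show ?thesis using True by (simp add: a_def)
    qed (use C in \<open>simp add: a_def\<close>)
    thus "eventually (\<lambda>(n, L). norm (a n L) \<le> norm (f n) * C) (at_top \<times>\<^sub>F sequentially)"
      by (intro always_eventually) auto
    show "summable (\<lambda>n. norm (f n) * C)"
      using f by (rule summable_mult2)
  qed simp
  moreover have "suminf (\<lambda>n. a n L) = (\<Sum>n\<le>L. f n * g n L)" for L
    by (subst suminf_finite[of "{..L}"]) (auto simp: a_def)
  moreover have "(\<Sum>n. f n * w) = suminf f * w"
    using summable_norm_cancel[OF f] by (rule suminf_mult2[symmetric])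
  ultimately show ?thesis by simp
qed

text \<open>Links the unordered sum over the integers to two ordinary series, to which Tannery's
  theorem applies.\<close>

lemma has_sum_int_split:
  fixes f :: "int \<Rightarrow> 'a::banach"
  assumes "summable (\<lambda>n. norm (f (int n)))" "summable (\<lambda>n. norm (f (- int (Suc n))))"
  shows "(f has_sum ((\<Sum>n. f (int n)) + (\<Sum>n. f (- int (Suc n))))) UNIV"
proof -
  have 1: "((\<lambda>n. f (int n)) has_sum (\<Sum>n. f (int n))) UNIV"
    using assms(1) by (rule norm_summable_imp_has_sum) (rule summable_sums[OF summable_norm_cancel[OF assms(1)]])
  have 2: "((\<lambda>n. f (- int (Suc n))) has_sum (\<Sum>n. f (- int (Suc n)))) UNIV"
    using assms(2) by (rule norm_summable_imp_has_sum) (rule summable_sums[OF summable_norm_cancel[OF assms(2)]])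
  have "bij_betw int UNIV {0..}"
    by (rule bij_betwI[of _ _ _ nat]) auto
  hence "(f has_sum (\<Sum>n. f (int n))) {0..}"
    using 1 by (simp add: has_sum_reindex_bij_betw)
  moreover have "bij_betw (\<lambda>n. - int (Suc n)) UNIV {..<0}"
    by (rule bij_betwI[of _ _ _ "\<lambda>r. nat (- r - 1)"]) auto
  from has_sum_reindex_bij_betw[OF this, of f] 2
  have "(f has_sum (\<Sum>n. f (- int (Suc n)))) {..<0}"
    by blast
  ultimately have "(f has_sum ((\<Sum>n. f (int n)) + (\<Sum>n. f (- int (Suc n))))) ({0..} \<union> {..<0})"
    by (rule has_sum_Un_disjoint) auto
  moreover have "{0..} \<union> {..<0} = (UNIV :: int set)" by auto
  ultimately show ?thesis by simp
qed

section \<open>Limits, zeros and bounds of \<open>q\<close>-shifted factorials\<close>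

lemma qpf_LIMSEQ: "norm q < 1 \<Longrightarrow> qpf q a \<longlonglongrightarrow> qpoch_inf a q"
  by (rule LIMSEQ_imp_Suc) (simp add: qpf_def lessThan_Suc_atMost qpoch_inf_LIMSEQ)

text \<open>An absolutely convergent product vanishes only if one of its factors does.\<close>

lemma qpoch_inf_eq_0_iff:
  assumes "norm q < 1"
  shows "qpoch_inf a q = 0 \<longleftrightarrow> (\<exists>k. a * q ^ k = 1)"
proof
  assume "\<exists>k. a * q ^ k = 1"
  then obtain k where "a * q ^ k = 1" ..
  thus "qpoch_inf a q = 0"
    using qpoch_inf_split[OF assms, of a "Suc k"] by simp
next
  assume 0: "qpoch_inf a q = 0"
  show "\<exists>k. a * q ^ k = 1"
  proof (rule ccontr)
    assume "\<nexists>k. a * q ^ k = 1"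
    hence nz: "1 - a * q ^ k \<noteq> 0" for k by (metis right_minus_eq)
    have "summable (\<lambda>k. norm a * norm q ^ k)"
      using assms by (intro summable_mult summable_geometric) auto
    hence "abs_convergent_prod (\<lambda>k. 1 - a * q ^ k)"
      by (intro summable_imp_abs_convergent_prod) (simp add: norm_mult norm_power)
    hence "convergent_prod (\<lambda>k. 1 - a * q ^ k)"
      by (rule abs_convergent_prod_imp_convergent_prod)
    hence "qpoch_inf a q \<noteq> 0"
      unfolding qpoch_inf_def by (rule prodinf_nonzero) (rule nz)
    with 0 show False by simp
  qed
qed

lemma qpf_nonzero:
  assumes "norm q < 1" "qpoch_inf a q \<noteq> 0"
  shows "qpf q a n \<noteq> 0"
  using qpoch_inf_split[OF assms(1), of a n] assms(2) by (auto simp: qpf_def)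

lemma qpoch_inf_self_nonzero:
  assumes "norm q < 1"
  shows "qpoch_inf q q \<noteq> 0"
proof
  assume "qpoch_inf q q = 0"
  then obtain k where "q ^ Suc k = 1"
    using qpoch_inf_eq_0_iff[OF assms] by auto
  hence "norm q ^ Suc k = 1" by (metis norm_one norm_power)
  moreover have "norm q ^ Suc k < 1"
    using power_decreasing[of 1 "Suc k" "norm q"] assms by simp
  ultimately show False by simp
qed

lemma qpf_bounded:
  assumes "norm (q :: complex) < 1"
  obtains C where "C > 0" "\<And>n. norm (qpf q a n) \<le> C"
  using convergent_imp_Bseq[OF convergentI[OF qpf_LIMSEQ[OF assms]]] that
  unfolding Bseq_def by blast

lemma qpf_inverse_bounded:
  assumes "norm q < 1" "qpoch_inf a q \<noteq> 0"
  obtains C where "C > 0" "\<And>n. norm (1 / qpf q a n) \<le> C"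
proof -
  have "(\<lambda>n. 1 / qpf q a n) \<longlonglongrightarrow> 1 / qpoch_inf a q"
    by (intro tendsto_intros qpf_LIMSEQ assms)
  from convergent_imp_Bseq[OF convergentI[OF this]] that show ?thesis
    unfolding Bseq_def by blast
qed

section \<open>The Bailey lemma in the limit\<close>

lemma bailey_kernel_LIMSEQ:
  assumes q: "norm q < 1"
  shows "(\<lambda>L. bailey_kernel q L r) \<longlonglongrightarrow> 1 / (qpoch_inf q q)\<^sup>2"
proof -
  have sub: "filterlim (\<lambda>L. nat (int L + r)) at_top sequentially" for r
    unfolding filterlim_at_top
  proof
    fix Z
    show "eventually (\<lambda>L. Z \<le> nat (int L + r)) sequentially"
      using eventually_ge_at_top[of "Z + nat (- r)"] by eventually_elim linarith
  qed
  have "(\<lambda>L. 1 / (qpf q q (nat (int L + - r)) * qpf q q (nat (int L + r))))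
           \<longlonglongrightarrow> 1 / (qpoch_inf q q * qpoch_inf q q)"
    using qpoch_inf_self_nonzero[OF q]
    by (intro tendsto_divide tendsto_mult tendsto_const filterlim_compose[OF qpf_LIMSEQ[OF q]] sub) auto
  moreover have "eventually (\<lambda>L. 1 / (qpf q q (nat (int L + - r)) * qpf q q (nat (int L + r)))
                    = bailey_kernel q L r) sequentially"
    using eventually_ge_at_top[of "nat \<bar>r\<bar>"]
    by eventually_elim (auto simp: bailey_kernel_def)
  ultimately show ?thesis
    unfolding power2_eq_square by (rule Lim_transform_eventually)
qed

lemma bailey_sum_LIMSEQ:
  assumes q: "norm q < 1"
    and d: "summable (\<lambda>n. norm (d (int n)))" "summable (\<lambda>n. norm (d (- int (Suc n))))"
  shows "(\<lambda>L. bailey_sum q L d) \<longlonglongrightarrow> (\<Sum>\<^sub>\<infinity>r\<in>UNIV. d r) / (qpoch_inf q q)\<^sup>2"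
proof -
  obtain C where C: "C > 0" "\<And>n. norm (1 / qpf q q n) \<le> C"
    using qpf_inverse_bounded[OF q qpoch_inf_self_nonzero[OF q]] by blast
  have bound: "norm (bailey_kernel q L r) \<le> C * C" for L r
  proof (cases "\<bar>r\<bar> \<le> int L")
    case True
    have "norm (bailey_kernel q L r)
        = norm (1 / qpf q q (nat (int L - r))) * norm (1 / qpf q q (nat (int L + r)))"
      using True by (simp add: bailey_kernel_def norm_divide norm_mult)
    also have "\<dots> \<le> C * C"
      using C by (intro mult_mono) auto
    finally show ?thesis .
  qed (use C in \<open>simp add: bailey_kernel_def\<close>)
  have "bailey_sum q L d = (\<Sum>n\<le>L. d (int n) * bailey_kernel q L (int n))
         + (\<Sum>n\<le>L. d (- int (Suc n)) * bailey_kernel q L (- int (Suc n)))" for L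
  proof -
    \<comment> \<open>The range is enlarged by \<open>- int (Suc L)\<close>, where the kernel is 0,
      so that both halves become sums over \<open>n \<le> L\<close>.\<close>
    have "bailey_sum q L d = (\<Sum>r\<in>{0..int L} \<union> {- int (Suc L)..<0}. d r * bailey_kernel q L r)"
      unfolding bailey_sum_def by (rule sum.mono_neutral_left) (auto simp: bailey_kernel_def)
    also have "\<dots> = (\<Sum>r\<in>{0..int L}. d r * bailey_kernel q L r)
                   + (\<Sum>r\<in>{- int (Suc L)..<0}. d r * bailey_kernel q L r)"
      by (rule sum.union_disjoint) auto
    also have "(\<Sum>r\<in>{0..int L}. d r * bailey_kernel q L r) = (\<Sum>n\<le>L. d (int n) * bailey_kernel q L (int n))"
      by (rule sum.reindex_bij_witness[of _ int nat]) auto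
    also have "(\<Sum>r\<in>{- int (Suc L)..<0}. d r * bailey_kernel q L r)
             = (\<Sum>n\<le>L. d (- int (Suc n)) * bailey_kernel q L (- int (Suc n)))"
      by (rule sum.reindex_bij_witness[of _ "\<lambda>n. - int (Suc n)" "\<lambda>r. nat (- r - 1)"]) auto
    finally show ?thesis .
  qed
  moreover have "(\<lambda>L. (\<Sum>n\<le>L. d (int n) * bailey_kernel q L (int n))
         + (\<Sum>n\<le>L. d (- int (Suc n)) * bailey_kernel q L (- int (Suc n))))
     \<longlonglongrightarrow> (\<Sum>n. d (int n)) * (1 / (qpoch_inf q q)\<^sup>2) + (\<Sum>n. d (- int (Suc n))) * (1 / (qpoch_inf q q)\<^sup>2)"
    by (intro tendsto_add tannery_bounded[where C = "C * C"] d bound bailey_kernel_LIMSEQ q)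
  moreover have "(\<Sum>\<^sub>\<infinity>r\<in>UNIV. d r) = (\<Sum>n. d (int n)) + (\<Sum>n. d (- int (Suc n)))"
    by (rule infsumI[OF has_sum_int_split[OF d]])
  ultimately show ?thesis by (simp add: add_divide_distrib)
qed

text \<open>The limit \<open>L \<rightarrow> \<infinity>\<close> of
  \<open>bailey_lemma_finite\<close>, by Tannery's theorem on both sides. Summability of the two
  series is assumed directly, which leaves the size of \<open>z\<close> free.\<close>

theorem bailey_lemma:
  assumes q: "q \<noteq> 0" "norm q < 1" and z: "z * x * y = q"
    and nz: "qpoch_inf (z * x) q \<noteq> 0" "qpoch_inf (z * y) q \<noteq> 0"
  defines "d \<equiv> \<lambda>c r. bailey_weight q x y z (nat \<bar>r\<bar>) * c r"
  assumes b: "summable (\<lambda>n. norm (qpf q x n * qpf q y n * z ^ n * bailey_sum q n c))"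
    and d: "summable (\<lambda>n. norm (d c (int n)))" "summable (\<lambda>n. norm (d c (- int (Suc n))))"
  shows "(\<Sum>n. qpf q x n * qpf q y n * z ^ n * bailey_sum q n c) * qpoch_inf z q * qpoch_inf q q
       = qpoch_inf (z * x) q * qpoch_inf (z * y) q * (\<Sum>\<^sub>\<infinity>r\<in>UNIV. d c r)"
proof -
  let ?f = "\<lambda>n. qpf q x n * qpf q y n * z ^ n * bailey_sum q n c"
  have qq: "qpoch_inf q q \<noteq> 0"
    by (rule qpoch_inf_self_nonzero[OF q(2)])
  define g where "g = (\<lambda>n. qpf q z n / qpf q q n)"
  have g: "g \<longlonglongrightarrow> qpoch_inf z q / qpoch_inf q q"
    unfolding g_def by (intro tendsto_divide qpf_LIMSEQ q qq)
  then obtain C where C: "\<And>n. norm (g n) \<le> C"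
    using convergent_imp_Bseq[OF convergentI[OF g]] unfolding Bseq_def by blast
  have gn: "(\<lambda>L. g (L - n)) \<longlonglongrightarrow> qpoch_inf z q / qpoch_inf q q" for n
    by (rule filterlim_compose[OF g]) (rule filterlim_minus_const_nat_at_top)
  have "(\<lambda>L. \<Sum>n\<le>L. ?f n * g (L - n)) \<longlonglongrightarrow> (\<Sum>n. ?f n) * (qpoch_inf z q / qpoch_inf q q)"
    by (intro tannery_bounded[where C = C] b C gn)
  moreover have "(\<Sum>n\<le>L. ?f n * g (L - n)) = qpf q (z * x) L * qpf q (z * y) L * bailey_sum q L (d c)" for L
    unfolding g_def d_def
    by (intro bailey_lemma_finite q z qpf_nonzero nz qq)
  moreover have "(\<lambda>L. qpf q (z * x) L * qpf q (z * y) L * bailey_sum q L (d c))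
     \<longlonglongrightarrow> qpoch_inf (z * x) q * qpoch_inf (z * y) q * ((\<Sum>\<^sub>\<infinity>r\<in>UNIV. d c r) / (qpoch_inf q q)\<^sup>2)"
    by (intro tendsto_mult qpf_LIMSEQ bailey_sum_LIMSEQ q d)
  ultimately have eq: "(\<Sum>n. ?f n) * (qpoch_inf z q / qpoch_inf q q)
     = qpoch_inf (z * x) q * qpoch_inf (z * y) q * ((\<Sum>\<^sub>\<infinity>r\<in>UNIV. d c r) / (qpoch_inf q q)\<^sup>2)"
    using LIMSEQ_unique by simp
  have "S * z' * Q = P * D" if "S * (z' / Q) = P * (D / Q\<^sup>2)" "Q \<noteq> 0" for S z' P D Q :: complex
    using that by (simp add: field_simps power2_eq_square)
  from this[OF eq qq] show ?thesis .
qed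

text \<open>The term is \<open>(A * B ^ n) ^ n\<close>, whose base tends to 0. No bound on
  \<open>A\<close> enters, so the Gaussian factor absorbs any power of \<open>z\<close>.\<close>

lemma summable_power_gauss:
  fixes A B :: real
  assumes "0 \<le> A" "0 \<le> B" "B < 1"
  shows "summable (\<lambda>n. A ^ n * B ^ (n\<^sup>2))"
proof -
  have "(\<lambda>n. A * B ^ n) \<longlonglongrightarrow> A * 0"
    using assms by (intro tendsto_mult tendsto_const LIMSEQ_power_zero) auto
  hence "eventually (\<lambda>n. A * B ^ n < 1 / 2) sequentially"
    by (intro order_tendstoD) auto
  hence "eventually (\<lambda>n. norm (A ^ n * B ^ (n\<^sup>2)) \<le> (1 / 2) ^ n) sequentially"
  proof eventually_elim
    case (elim n)
    have "norm (A ^ n * B ^ (n\<^sup>2)) = (A * B ^ n) ^ n"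
      using assms by (simp add: power_mult_distrib power2_eq_square power_mult)
    also have "\<dots> \<le> (1 / 2) ^ n"
      using elim assms by (intro power_mono) auto
    finally show ?case .
  qed
  thus ?thesis
    by (rule summable_comparison_test_ev) (rule summable_geometric, simp)
qed

section \<open>The bilateral series\<close>

lemma qpoch_of_nat:
  assumes "0 < norm q" "norm q < 1"
  shows "qpoch a q (int n) = qpf q a n"
  by (simp add: qpoch_eq[OF assms] qpf_def)

lemma qpoch_neg:
  assumes "0 < norm q" "norm q < 1"
  shows "qpoch a q (- int n) = 1 / (\<Prod>k=1..n. 1 - a / q ^ k)"
  by (cases "n = 0") (simp_all add: qpoch_eq[OF assms])

text \<open>Each factor is reflected by extracting powers of \<open>q\<close> and \<open>x\<close>.
  This is what makes the bilateral summand even.\<close>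

lemma qpoch_quotient_neg:
  assumes q: "0 < norm q" "norm q < 1" and "x \<noteq> 0" and x: "\<And>k. x \<noteq> q ^ Suc k"
  shows "qpoch x q (- int n) / qpoch (q / x) q (- int n) = qpf q x n / qpf q (q / x) n * (q / x\<^sup>2) ^ n"
proof -
  have q0: "q \<noteq> 0" using q by auto
  have "(\<Prod>k=1..n. 1 - q / x / q ^ k) / (\<Prod>k=1..n. 1 - x / q ^ k)
      = qpf q x n / qpf q (q / x) n * (q / x\<^sup>2) ^ n"
  proof (induction n)
    case (Suc n)
    have step: "(1 - q / x / q ^ Suc n) / (1 - x / q ^ Suc n)
        = (1 - x * q ^ n) / (1 - q / x * q ^ n) * (q / x\<^sup>2)"
    proof -
      have "q ^ Suc n - x \<noteq> 0" "x - q ^ Suc n \<noteq> 0"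
        using x[of n] by auto
      thus ?thesis
        using q0 \<open>x \<noteq> 0\<close> by (simp add: divide_simps) (simp add: algebra_simps power2_eq_square)
    qed
    have "(\<Prod>k=1..Suc n. 1 - q / x / q ^ k) / (\<Prod>k=1..Suc n. 1 - x / q ^ k)
        = (\<Prod>k=1..n. 1 - q / x / q ^ k) / (\<Prod>k=1..n. 1 - x / q ^ k)
          * ((1 - q / x / q ^ Suc n) / (1 - x / q ^ Suc n))"
      by (simp del: power_Suc)
    also have "\<dots> = qpf q x (Suc n) / qpf q (q / x) (Suc n) * (q / x\<^sup>2) ^ Suc n"
      unfolding Suc.IH step by (simp add: qpf_Suc mult_ac)
    finally show ?case .
  qed simp
  \<comment> \<open>If \<open>x = q^(-m)\<close> with \<open>m < n\<close>, the denominator on the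
    left has a pole and is read as \<open>1 / 0 = 0\<close>; the quotient is then 0, in accordance
    with the zero of \<open>qpf q x n\<close>.\<close>
  thus ?thesis
    by (simp add: qpoch_neg[OF q])
qed

text \<open>For negative \<open>m\<close> the two reflections contribute
  \<open>q / x\<^sup>2\<close> and \<open>q / y\<^sup>2\<close>, which together with
  \<open>x y / q\<close> give back \<open>q / (x y)\<close>.\<close>

lemma bailey_weight_int:
  assumes q: "0 < norm q" "norm q < 1" and x: "x \<noteq> 0" "\<And>k. x \<noteq> q ^ Suc k"
    and y: "y \<noteq> 0" "\<And>k. y \<noteq> q ^ Suc k"
  shows "bailey_weight q x y (q / (x * y)) (nat \<bar>m\<bar>)
       = (qpoch x q m * qpoch y q m) / (qpoch (q / x) q m * qpoch (q / y) q m)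
           * (1 / (x * y)) powi m * q powi m"
proof -
  have q0: "q \<noteq> 0" using q by auto
  have W: "bailey_weight q x y (q / (x * y)) n
      = (qpf q x n / qpf q (q / x) n) * (qpf q y n / qpf q (q / y) n) * (q / (x * y)) ^ n" for n
    using x(1) y(1) by (simp add: bailey_weight_def mult_ac)
  show ?thesis
  proof (cases m)
    case (nonneg n)
    thus ?thesis
      by (simp add: W qpoch_of_nat[OF q] power_divide)
  next
    case (neg n)
    define N where "N = Suc n"
    have m: "m = - int N" "nat \<bar>m\<bar> = N"
      using neg by (auto simp: N_def)
    have inv: "inverse ((1 / (x * y)) ^ N) * inverse (q ^ N) = ((x * y) / q) ^ N"
      by (simp add: power_divide divide_inverse power_mult_distrib power_inverse)
    have "(qpoch x q m * qpoch y q m) / (qpoch (q / x) q m * qpoch (q / y) q m)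
            * (1 / (x * y)) powi m * q powi m
        = (qpoch x q m / qpoch (q / x) q m) * (qpoch y q m / qpoch (q / y) q m) * ((x * y) / q) ^ N"
      unfolding m(1) power_int_minus power_int_of_nat
      by (simp only: times_divide_times_eq mult.assoc flip: inv)
    also have "\<dots> = (qpf q x N / qpf q (q / x) N) * (qpf q y N / qpf q (q / y) N)
         * ((q / x\<^sup>2) * (q / y\<^sup>2) * ((x * y) / q)) ^ N"
      unfolding m(1) qpoch_quotient_neg[OF q x] qpoch_quotient_neg[OF q y]
      by (simp only: power_mult_distrib mult_ac)
    also have "(q / x\<^sup>2) * (q / y\<^sup>2) * ((x * y) / q) = q / (x * y)"
      using q0 x(1) y(1) by (simp add: field_simps power2_eq_square)
    finally show ?thesis by (simp only: m(2) W)
  qed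
qed

lemma bailey_weight_bounded:
  assumes q: "norm q < 1" and nz: "qpoch_inf (z * x) q \<noteq> 0" "qpoch_inf (z * y) q \<noteq> 0"
  obtains C where "C > 0" "\<And>n. norm (bailey_weight q x y z n) \<le> C * norm z ^ n"
proof -
  obtain A where A: "A > 0" "\<And>n. norm (qpf q x n) \<le> A"
    using qpf_bounded[OF q, of x] by blast
  obtain B where B: "B > 0" "\<And>n. norm (qpf q y n) \<le> B"
    using qpf_bounded[OF q, of y] by blast
  obtain A' where A': "A' > 0" "\<And>n. norm (1 / qpf q (z * x) n) \<le> A'"
    using qpf_inverse_bounded[OF q nz(1)] by blast
  obtain B' where B': "B' > 0" "\<And>n. norm (1 / qpf q (z * y) n) \<le> B'"
    using qpf_inverse_bounded[OF q nz(2)] by blast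
  have "norm (bailey_weight q x y z n) \<le> (A * B * A' * B') * norm z ^ n" for n
  proof -
    have "norm (bailey_weight q x y z n) = (norm (qpf q x n) * norm (qpf q y n)
        * norm (1 / qpf q (z * x) n) * norm (1 / qpf q (z * y) n)) * norm z ^ n"
      by (simp add: bailey_weight_def norm_mult norm_divide norm_power)
    also have "\<dots> \<le> (A * B * A' * B') * norm z ^ n"
      using A B A' B' by (intro mult_mono mult_nonneg_nonneg) (auto intro: less_imp_le)
    finally show ?thesis .
  qed
  moreover have "A * B * A' * B' > 0" using A(1) B(1) A'(1) B'(1) by simp
  ultimately show ?thesis using that by blast
qed

lemma norm_chi3_le: "norm (chi3 r :: complex) \<le> 1"
  by (simp add: chi3_def)

text \<open>The factor \<open>q^r\<close> of the weight cancels \<open>p powi (- 3 * r)\<close>,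
  leaving \<open>p powi r\<^sup>2\<close>. For \<open>r\<close> prime to 3 the square is 1 modulo 3:
  hence the factor \<open>p\<close> and the exponents of \<open>T1_term\<close> and
  \<open>T2_term\<close>.\<close>

lemma T_terms_eq_bailey_weight:
  assumes q: "0 < norm q" "norm q < 1" and x: "x \<noteq> 0" "\<And>k. x \<noteq> q ^ Suc k"
    and y: "y \<noteq> 0" "\<And>k. y \<noteq> q ^ Suc k" and p: "p ^ 3 = q"
  defines "d \<equiv> \<lambda>r. bailey_weight q x y (q / (x * y)) (nat \<bar>r\<bar>) * (chi3 r * p powi (r\<^sup>2 - 3 * r))"
  shows "d (3 * n) = 0" "d (3 * n + 1) = p * T1_term x y q n" "d (3 * n + 2) = - p * T2_term x y q n"
proof -
  have p0: "p \<noteq> 0" using q p by auto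
  have qp: "q powi m = p powi (3 * m)" for m
    using power_int_mult[of p 3 m] by (simp add: p)
  define t where "t = (\<lambda>m. (qpoch x q m * qpoch y q m) / (qpoch (q / x) q m * qpoch (q / y) q m)
           * (1 / (x * y)) powi m)"
  have d: "d m = chi3 m * t m * p powi m\<^sup>2" for m
  proof -
    have "d m = chi3 m * t m * (p powi (3 * m) * p powi (m\<^sup>2 - 3 * m))"
      unfolding d_def bailey_weight_int[OF q x y] by (simp add: t_def qp mult_ac)
    also have "p powi (3 * m) * p powi (m\<^sup>2 - 3 * m) = p powi m\<^sup>2"
      using p0 by (simp flip: power_int_add)
    finally show ?thesis .
  qed
  have sq: "(3 * n + 1)\<^sup>2 = 1 + 3 * (3 * n\<^sup>2 + 2 * n)" "(3 * n + 2)\<^sup>2 = 1 + 3 * (3 * n\<^sup>2 + 4 * n + 1)"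
    by (simp_all add: power2_eq_square algebra_simps)
  have pw: "p powi (1 + 3 * k) = p * q powi k" for k
    using p0 by (simp add: qp power_int_add)
  have c: "chi3 (3 * n) = (0::complex)" "chi3 (3 * n + 1) = (1::complex)" "chi3 (3 * n + 2) = (- 1::complex)"
    by (simp_all add: chi3_def)
  show "d (3 * n) = 0" by (simp add: d c)
  show "d (3 * n + 1) = p * T1_term x y q n"
    unfolding d c sq pw by (simp add: t_def T1_term_def)
  show "d (3 * n + 2) = - p * T2_term x y q n"
    unfolding d c sq pw by (simp add: t_def T2_term_def)
qed

text \<open>The residue classes modulo 3 split the sum; class 0 contributes nothing. Restriction to
  a class also gives the convergence of \<open>T1\<close> and \<open>T2\<close>.\<close>

lemma T_series:
  assumes q: "0 < norm q" "norm q < 1" and x: "x \<noteq> 0" "\<And>k. x \<noteq> q ^ Suc k"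
    and y: "y \<noteq> 0" "\<And>k. y \<noteq> q ^ Suc k" and p: "p ^ 3 = q"
  defines "d \<equiv> \<lambda>r. bailey_weight q x y (q / (x * y)) (nat \<bar>r\<bar>) * (chi3 r * p powi (r\<^sup>2 - 3 * r))"
  assumes d: "d summable_on UNIV"
  shows "T1_term x y q summable_on UNIV" "T2_term x y q summable_on UNIV"
    "(\<Sum>\<^sub>\<infinity>r\<in>UNIV. d r) = p * (T1 x y q - T2 x y q)"
proof -
  have dT: "d (3 * n) = 0" "d (3 * n + 1) = p * T1_term x y q n" "d (3 * n + 2) = - p * T2_term x y q n" for n
    using T_terms_eq_bailey_weight[OF q x y p, of n] by (simp_all only: d_def)
  have p0: "p \<noteq> 0" using q p by auto
  define R where "R = (\<lambda>i. range (\<lambda>n::int. 3 * n + i))"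
  have inj: "inj (\<lambda>n::int. 3 * n + i)" for i
    by (auto intro: injI)
  have sum: "(\<lambda>n. d (3 * n + i)) summable_on UNIV" for i
    using summable_on_reindex[OF inj, of d i] summable_on_subset_banach[OF d, of "R i"]
    by (simp add: R_def o_def)
  have has: "(d has_sum (\<Sum>\<^sub>\<infinity>n. d (3 * n + i))) (R i)" for i
    unfolding R_def has_sum_reindex[OF inj] using has_sum_infsum[OF sum[of i]] by (simp add: o_def)
  have "(\<lambda>n. (1 / p) * d (3 * n + 1)) summable_on UNIV"
    by (intro summable_on_cmult_right sum)
  thus 1: "T1_term x y q summable_on UNIV" using p0 by (simp add: dT)
  have "(\<lambda>n. (- 1 / p) * d (3 * n + 2)) summable_on UNIV"
    by (intro summable_on_cmult_right sum)
  thus 2: "T2_term x y q summable_on UNIV" using p0 by (simp add: dT)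
  have "(d has_sum ((\<Sum>\<^sub>\<infinity>n. d (3 * n + 1)) + (\<Sum>\<^sub>\<infinity>n. d (3 * n + 2)))) (R 1 \<union> R 2)"
  proof (intro has_sum_Un_disjoint has)
    have "3 * m + 1 \<noteq> 3 * n + (2::int)" for m n by presburger
    thus "R 1 \<inter> R 2 = {}" by (auto simp: R_def)
  qed
  also have "?this \<longleftrightarrow> (d has_sum ((\<Sum>\<^sub>\<infinity>n. d (3 * n + 1)) + (\<Sum>\<^sub>\<infinity>n. d (3 * n + 2)))) UNIV"
  proof (rule has_sum_cong_neutral)
    fix r assume r: "r \<in> UNIV - (R 1 \<union> R 2)"
    have "\<exists>n. r = 3 * n \<or> r = 3 * n + 1 \<or> r = 3 * n + 2" by presburger
    then obtain n where "r = 3 * n" using r by (auto simp: R_def)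
    thus "d r = 0" by (simp add: dT)
  qed auto
  finally have "(\<Sum>\<^sub>\<infinity>r\<in>UNIV. d r) = (\<Sum>\<^sub>\<infinity>n. d (3 * n + 1)) + (\<Sum>\<^sub>\<infinity>n. d (3 * n + 2))"
    by (rule infsumI)
  also have "\<dots> = p * T1 x y q + (- p) * T2 x y q"
    unfolding dT T1_def T2_def using 1 2 by (simp only: infsum_cmult_right)
  finally show "(\<Sum>\<^sub>\<infinity>r\<in>UNIV. d r) = p * (T1 x y q - T2 x y q)"
    by (simp add: algebra_simps)
qed

theorem theorem8:
  fixes x y q :: complex
  assumes "0 < norm q" and "norm q < 1"
    and "x \<noteq> 0" and "y \<noteq> 0"
    and "\<forall>k::nat. x \<noteq> q ^ (k + 1)" and "\<forall>k::nat. y \<noteq> q ^ (k + 1)"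
    and "\<forall>k::nat. x * y \<noteq> q ^ (k + 1)"
  shows "T1_term x y q summable_on UNIV \<and> T2_term x y q summable_on UNIV \<and>
    ((\<lambda>n::nat. qpoch x q (int n) * qpoch y q (int n) / qpoch q q (2 * int n - 1)
        * (1 / (x * y)) ^ n * q ^ (n^2 - n))
      has_sum (T1 x y q - T2 x y q) * (qpoch_inf (q/x) q * qpoch_inf (q/y) q)
              / (qpoch_inf q q * qpoch_inf (q / (x * y)) q)) {1..}"
proof -
  note q = assms(1,2)
  have q0: "q \<noteq> 0" using q by auto
  have x: "x \<noteq> 0" "\<And>k. x \<noteq> q ^ Suc k" and y: "y \<noteq> 0" "\<And>k. y \<noteq> q ^ Suc k"
    using assms by auto
  \<comment> \<open>Any cube root serves: \<open>p\<close> enters both sides of the Bailey lemma as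
    a common factor and is divided out at the end.\<close>
  obtain p where p: "p ^ 3 = q"
  proof
    show "exp (Ln q / 3) ^ 3 = q"
      using q0 by (simp flip: exp_of_nat_mult)
  qed
  have p0: "p \<noteq> 0" and p1: "norm p < 1"
  proof -
    show "p \<noteq> 0" using p q0 by auto
    have "norm p ^ 3 < 1" using q(2) by (simp flip: p norm_power)
    thus "norm p < 1" by (simp add: power_less_one_iff)
  qed
  define z where "z = q / (x * y)"
  have z: "z * x * y = q" and zx: "z * x = q / y" and zy: "z * y = q / x"
    using x(1) y(1) by (simp_all add: z_def)
  have nz: "qpoch_inf (q / a) q \<noteq> 0" if "a \<noteq> 0" "\<And>k. a \<noteq> q ^ Suc k" for a
    using that by (auto simp: qpoch_inf_eq_0_iff[OF q(2)] field_simps)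
  have nzx: "qpoch_inf (z * x) q \<noteq> 0" and nzy: "qpoch_inf (z * y) q \<noteq> 0" and nzz: "qpoch_inf z q \<noteq> 0"
    using nz[OF x] nz[OF y] nz[of "x * y"] x(1) y(1) assms(7) by (auto simp: zx zy z_def)
  have qq: "qpoch_inf q q \<noteq> 0" by (rule qpoch_inf_self_nonzero[OF q(2)])
  have qqn: "qpf q q n \<noteq> 0" for n by (rule qpf_nonzero[OF q(2) qq])

  define c where "c = (\<lambda>r. chi3 r * p powi (r\<^sup>2 - 3 * r))"
  define d where "d = (\<lambda>r. bailey_weight q x y z (nat \<bar>r\<bar>) * c r)"
  have bsum: "bailey_sum q n c = p * p ^ (3 * n\<^sup>2) * (1 - p ^ (6 * n)) / (p ^ (6 * n) * qpf q q (2 * n))" for n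
    using gauss_sum_bailey_pair[of p n] p0 qqn by (simp add: gauss_sum_def c_def p)

  obtain C where C: "C > 0" "\<And>n. norm (bailey_weight q x y z n) \<le> C * norm z ^ n"
    using bailey_weight_bounded[OF q(2) nzx nzy] by blast
  have d_bound: "norm (d r) \<le> C * norm z ^ nat \<bar>r\<bar> * norm p powi (r\<^sup>2 - 3 * r)" for r
  proof -
    have "norm (d r) = norm (bailey_weight q x y z (nat \<bar>r\<bar>)) * (norm (chi3 r :: complex) * norm p powi (r\<^sup>2 - 3 * r))"
      by (simp add: d_def c_def norm_mult norm_power_int)
    also have "\<dots> \<le> (C * norm z ^ nat \<bar>r\<bar>) * (1 * norm p powi (r\<^sup>2 - 3 * r))"
      using C by (intro mult_mono norm_chi3_le) auto
    finally show ?thesis by simp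
  qed
  have d1: "summable (\<lambda>n. norm (d (int n)))"
  proof (rule summable_comparison_test)
    \<comment> \<open>The linear part \<open>- 3 * n\<close> of the exponent goes into the base
      \<open>A\<close> of \<open>summable_power_gauss\<close>, however large that becomes.\<close>
    have "norm p powi ((int n)\<^sup>2 - 3 * int n) = norm p ^ n\<^sup>2 / (norm p ^ 3) ^ n" for n
    proof -
      have "norm p powi ((int n)\<^sup>2 - 3 * int n) = norm p powi int (n\<^sup>2) / norm p powi int (3 * n)"
        using p0 by (simp add: power_int_diff)
      thus ?thesis by (simp only: power_int_of_nat power_mult)
    qed
    hence "norm (norm (d (int n))) \<le> C * ((norm z / norm p ^ 3) ^ n * norm p ^ n\<^sup>2)" for n
      using d_bound[of "int n"] by (simp add: power_divide)
    thus "\<exists>N. \<forall>n\<ge>N. norm (norm (d (int n))) \<le> C * ((norm z / norm p ^ 3) ^ n * norm p ^ n\<^sup>2)"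
      by blast
    show "summable (\<lambda>n. C * ((norm z / norm p ^ 3) ^ n * norm p ^ n\<^sup>2))"
      using p1 by (intro summable_mult summable_power_gauss) auto
  qed
  have d2: "summable (\<lambda>n. norm (d (- int (Suc n))))"
  proof -
    have "summable (\<lambda>n. norm (d (- int n)))"
    proof (rule summable_comparison_test)
      have "norm p powi ((- int n)\<^sup>2 - 3 * (- int n)) = norm p ^ n\<^sup>2 * (norm p ^ 3) ^ n" for n
      proof -
        have "norm p powi ((- int n)\<^sup>2 - 3 * (- int n)) = norm p powi int (n\<^sup>2) * norm p powi int (3 * n)"
          using p0 by (simp add: power_int_add)
        thus ?thesis by (simp only: power_int_of_nat power_mult)
      qed
      hence "norm (norm (d (- int n))) \<le> C * ((norm z * norm p ^ 3) ^ n * norm p ^ n\<^sup>2)" for n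
        using d_bound[of "- int n"] by (simp add: power_mult_distrib mult_ac)
      thus "\<exists>N. \<forall>n\<ge>N. norm (norm (d (- int n))) \<le> C * ((norm z * norm p ^ 3) ^ n * norm p ^ n\<^sup>2)"
        by blast
      show "summable (\<lambda>n. C * ((norm z * norm p ^ 3) ^ n * norm p ^ n\<^sup>2))"
        using p1 by (intro summable_mult summable_power_gauss) auto
    qed
    thus ?thesis by (subst summable_Suc_iff[of "\<lambda>n. norm (d (- int n))"])
  qed
  have d: "d summable_on UNIV"
    using has_sum_int_split[OF d1 d2] by (rule has_sum_imp_summable)
  have d_eq: "d = (\<lambda>r. bailey_weight q x y (q / (x * y)) (nat \<bar>r\<bar>) * (chi3 r * p powi (r\<^sup>2 - 3 * r)))"
    by (simp add: d_def c_def z_def)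
  note T = T_series[OF q x y p, folded d_eq, OF d]

  define f where "f = (\<lambda>n. qpf q x n * qpf q y n * z ^ n * bailey_sum q n c)"
  have f: "summable (\<lambda>n. norm (f n))"
  proof -
    obtain A where A: "A > 0" "\<And>n. norm (qpf q x n) \<le> A"
      using qpf_bounded[OF q(2), of x] by blast
    obtain B where B: "B > 0" "\<And>n. norm (qpf q y n) \<le> B"
      using qpf_bounded[OF q(2), of y] by blast
    obtain E where E: "E > 0" "\<And>n. norm (1 / qpf q q n) \<le> E"
      using qpf_inverse_bounded[OF q(2) qq] by blast
    show ?thesis
    proof (rule summable_comparison_test)
      show "summable (\<lambda>n. (A * B * 2 * E * norm p) * ((norm z / norm p ^ 6) ^ n * (norm p ^ 3) ^ n\<^sup>2))"
        using p1 by (intro summable_mult summable_power_gauss) (auto simp: power_less_one_iff)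
      have "norm (f n) \<le> (A * B * 2 * E * norm p) * ((norm z / norm p ^ 6) ^ n * (norm p ^ 3) ^ n\<^sup>2)" for n
      proof -
        have "norm (1 - p ^ (6 * n)) \<le> norm (1::complex) + norm (p ^ (6 * n))"
          by (rule norm_triangle_ineq4)
        also have "\<dots> \<le> 2"
          using p1 by (simp add: norm_power power_le_one)
        finally have 2: "norm (1 - p ^ (6 * n)) \<le> 2" .
        have "norm (f n) = (norm (qpf q x n) * norm (qpf q y n) * norm (1 - p ^ (6 * n))
             * norm (1 / qpf q q (2 * n)) * norm p) * ((norm z / norm p ^ 6) ^ n * (norm p ^ 3) ^ n\<^sup>2)"
          by (simp add: f_def bsum norm_mult norm_divide norm_power power_divide power_mult)
            (simp add: mult_ac)
        also have "\<dots> \<le> (A * B * 2 * E * norm p) * ((norm z / norm p ^ 6) ^ n * (norm p ^ 3) ^ n\<^sup>2)"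
          using A B E 2 by (intro mult_right_mono mult_mono mult_nonneg_nonneg) (auto intro: less_imp_le)
        finally show ?thesis .
      qed
      thus "\<exists>N. \<forall>n\<ge>N. norm (norm (f n))
          \<le> (A * B * 2 * E * norm p) * ((norm z / norm p ^ 6) ^ n * (norm p ^ 3) ^ n\<^sup>2)"
        by simp
    qed
  qed
  \<comment> \<open>By \<open>T(3)\<close> the series on the right carries a factor
    \<open>p\<close>; division by \<open>p\<close> and by the nonzero infinite products isolates the
    claimed value.\<close>
  have "suminf f * qpoch_inf z q * qpoch_inf q q
       = qpoch_inf (z * x) q * qpoch_inf (z * y) q * (\<Sum>\<^sub>\<infinity>r\<in>UNIV. d r)"
    using bailey_lemma[OF q0 q(2) z nzx nzy, of c] f d1 d2 unfolding f_def d_def by simp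
  hence S: "suminf f / p = (T1 x y q - T2 x y q) * (qpoch_inf (q/x) q * qpoch_inf (q/y) q)
              / (qpoch_inf q q * qpoch_inf (q / (x * y)) q)"
    unfolding T(3) zx zy z_def[symmetric] using qq nzz p0 by (simp add: field_simps)
  have "(f has_sum suminf f) UNIV"
    using f by (rule norm_summable_imp_has_sum) (rule summable_sums[OF summable_norm_cancel[OF f]])
  hence "((\<lambda>n. f n / p) has_sum (suminf f / p)) UNIV"
    using has_sum_cmult_left[of f UNIV "suminf f" "1 / p"] by simp
  also have "?this \<longleftrightarrow> ((\<lambda>n::nat. qpoch x q (int n) * qpoch y q (int n) / qpoch q q (2 * int n - 1)
        * (1 / (x * y)) ^ n * q ^ (n^2 - n)) has_sum (suminf f / p)) {1..}"
  proof (rule has_sum_cong_neutral)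
    fix n :: nat assume "n \<in> UNIV - {1..}"
    hence "n = 0" by auto
    \<comment> \<open>At \<open>n = 0\<close> the factor \<open>1 - p ^ (6 * n)\<close>
      vanishes.\<close>
    thus "f n / p = 0" by (simp add: f_def bsum)
  next
    fix n :: nat assume "n \<in> UNIV \<inter> {1..}"
    hence n: "n \<ge> 1" by auto
    have i: "2 * int n - 1 = int (2 * n - 1)" using n by auto
    have n2: "2 * n = Suc (2 * n - 1)" using n by auto
    have p6: "p ^ (6 * n) = q ^ (2 * n)" and p3: "p ^ (3 * n\<^sup>2) = q ^ n\<^sup>2"
      by (simp_all flip: p power_mult)
    have "qpf q q (2 * n) = qpf q q (2 * n - 1) * (1 - q ^ (2 * n))"
      by (subst (1 2) n2) (simp add: qpf_Suc)
    moreover have "1 - q ^ (2 * n) \<noteq> 0"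
      using calculation qqn[of "2 * n"] by auto
    \<comment> \<open>Cancelling \<open>1 - q ^ (2 * n)\<close> against the last factor of
      \<open>(q;q)_(2n)\<close> leaves \<open>(q;q)_(2n-1)\<close>.\<close>
    ultimately have b: "bailey_sum q n c / p = q ^ n\<^sup>2 / (q ^ (2 * n) * qpf q q (2 * n - 1))"
      using p0 unfolding bsum p6 p3 by simp
    have "n \<le> n\<^sup>2" using n by (simp add: power2_eq_square)
    hence e: "q ^ n\<^sup>2 = q ^ (n\<^sup>2 - n) * q ^ n"
      by (simp flip: power_add)
    have "f n / p = qpf q x n * qpf q y n * z ^ n * (bailey_sum q n c / p)"
      by (simp add: f_def)
    also have "\<dots> = qpf q x n * qpf q y n / qpf q q (2 * n - 1) * (1 / (x * y)) ^ n * q ^ (n\<^sup>2 - n)"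
      unfolding b e z_def using q0 by (simp add: power_divide mult_2 power_add) (simp add: mult_ac)
    finally show "f n / p = qpoch x q (int n) * qpoch y q (int n) / qpoch q q (2 * int n - 1)
        * (1 / (x * y)) ^ n * q ^ (n^2 - n)"
      unfolding i qpoch_of_nat[OF q] .
  qed auto
  finally show ?thesis
    using T(1,2) unfolding S by blast
qed

end
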